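(* Let $X$ be a compact, connected, locally connected, metrizable topological space, and let $f: X \to X$ be a topological coarse expanding conformal (topological cxc) dynamical system. If $X$ contains a homeomorphic copy of $\mathbb{Y}$ and $\inf\{\dim_H(X,d): d\in\mathcal{G}(f)\}=1$, where $\dim_H$ denotes Hausdorff dimension and $\mathcal{G}(f)$ is the canonical gauge of $f$, then this infimum (the conformal dimension of $(X,\mathcal{G}(f))$) is not attained by any metric $d\in\mathcal{G}(f)$.
   Context: $\mathbb{Y}=[0,e_1]\cup[0,e_2]\cup[0,e_3]\subset\mathbb{R}^3$, where $e_1,e_2,e_3$ is the standard basis: three unit segments meeting at the origin. $\mathbb{N}=\{0,1,2,\dots\}$. Finite branched coverings. For compact Hausdorff connected locally connected spaces $X,Z$ and a finite-to-one continuous map $f:X\to Z$, put $\deg(f)=\sup\{\#f^{-1}(z): z\in Z\}$ (the same definition is used for restrictions $f:\widetilde U\to U$) and $\deg(f;x)=\inf_U\sup\{\#(f^{-1}(z)\cap U): z\in f(U)\}$, the infimum over all neighborhoods $U$ of $x$. $f$ is a finite branched covering (fbc) if $\deg(f)<\infty$ and (i) $\sum_{x\in f^{-1}(z)}\deg(f;x)=\deg(f)$ for every $z\in Z$; (ii) for every $x_0\in X$ there are compact neighborhoods $U$ of $x_0$ and $V$ of $f(x_0)$ with $\sum_{x\in U, f(x)=z}\deg(f;x)=\deg(f;x_0)$ for all $z\in V$. Topological cxc. Let $X$ be a non-singleton compact, connected, locally connected, metrizable space and $f:X\to X$ an fbc. Let $\mathcal{U}_0$ be a finite cover of $X$ by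 nonempty open connected sets; for $n\ge1$ let $\mathcal{U}_n$ be the collection of connected components of the sets $f^{-1}(U)$, $U\in\mathcal{U}_{n-1}$. $f$ is topological cxc with respect to $\mathcal{U}_0$ if: (Expansion) for every open cover $\mathcal{V}$ of $X$ there is $N$ such that for every $n>N$ each $U\in\mathcal{U}_n$ is contained in some $V\in\mathcal{V}$; (Degree) $\max\{\deg(f^k:\widetilde U\to U): k\in\mathbb{N},\ \widetilde U\in\mathcal{U}_k,\ U=f^k(\widetilde U)\in\mathcal{U}_0\}<\infty$; (Irreducibility) for every nonempty open $W\subset X$ there is $n\in\mathbb{N}$ with $f^n(W)=X$. $f$ is topological cxc if this holds for some such $\mathcal{U}_0$. Metric cxc. Let $d$ be a metric inducing the topology of $X$. For $a$ in the interior of $A$ let $\mathrm{round}(A,a)=\sup\{d(x,a):x\in A\}/\sup\{r: B(a,r)\subset A\}$. $f$ is metric cxc with respect to $d$ if for some $\mathcal{U}_0$ it is topological cxc with respect to $\mathcal{U}_0$ and there exist continuous increasing embeddings $\rho_\pm:[1,\infty)\to[1,\infty)$ and increasing homeomorphisms $\delta_\pm:[0,\infty)\to[0,\infty)$ such that: (Roundness distortion) for all $n,k\in\mathbb{N}$, $U\in\mathcal{U}_n$, $\widetilde U\in\mathcal{U}_{n+k}$, $\tilde y\in\widetilde U$, $y\in U$ with $f^k(\widetilde U)=U$, $f^k(\tilde y)=y$: $\mathrm{round}(\widetilde U,\tilde y)<\rho_-(\mathrm{round}(U,y))$ and $\mathrm{round}(U,y)<\rho_+(\mathrm{round}(\widetilde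 U,\tilde y))$; (Diameter distortion) for all $n_0,n_1,k\in\mathbb{N}$, $U\in\mathcal{U}_{n_0}$, $U'\in\mathcal{U}_{n_1}$, $\widetilde U\in\mathcal{U}_{n_0+k}$, $\widetilde U'\in\mathcal{U}_{n_1+k}$ with $U'\subset U$, $\widetilde U'\subset\widetilde U$, $f^k(\widetilde U)=U$, $f^k(\widetilde U')=U'$: $\frac{\operatorname{diam}\widetilde U'}{\operatorname{diam}\widetilde U}<\delta_-\!\left(\frac{\operatorname{diam}U'}{\operatorname{diam}U}\right)$ and $\frac{\operatorname{diam}U'}{\operatorname{diam}U}<\delta_+\!\left(\frac{\operatorname{diam}\widetilde U'}{\operatorname{diam}\widetilde U}\right)$. Canonical gauge. $\mathcal{G}(f)$ is the set of all metrics $d$ on $X$ (inducing its topology) with respect to which $f$ is metric cxc. (It is a known fact that for topological cxc $f$ this set is nonempty and is a single quasi-symmetric equivalence class of metrics.) *)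

theory Defs
  imports "HOL-Analysis.Analysis" "HOL-Library.Extended_Nat"
begin

definition tripod :: "(real^3) set" where
  "tripod = closed_segment 0 (axis 1 1) \<union> closed_segment 0 (axis 2 1) \<union> closed_segment 0 (axis 3 1)"

definition neighborhood :: "'a topology \<Rightarrow> 'a \<Rightarrow> 'a set \<Rightarrow> bool" where
  "neighborhood X x U \<longleftrightarrow> U \<subseteq> topspace X \<and> x \<in> X interior_of U"

text \<open>The degree of the restriction \<open>f : A \<rightarrow> B\<close>. Since \<open>card\<close> is 0 on infinite sets, this is
  meaningful only for maps with finite fibres.\<close>

definition degree_between :: "('a \<Rightarrow> 'b) \<Rightarrow> 'a set \<Rightarrow> 'b set \<Rightarrow> enat" where
  "degree_between f A B = (SUP z\<in>B. enat (card {x \<in> A. f x = z}))"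

definition local_degree :: "'a topology \<Rightarrow> ('a \<Rightarrow> 'b) \<Rightarrow> 'a \<Rightarrow> enat" where
  "local_degree X f x = (INF U\<in>{U. neighborhood X x U}. degree_between f U (f ` U))"

definition finite_branched_covering :: "'a topology \<Rightarrow> 'b topology \<Rightarrow> ('a \<Rightarrow> 'b) \<Rightarrow> bool" where
  "finite_branched_covering X Z f \<longleftrightarrow>
     compact_space X \<and> Hausdorff_space X \<and> connected_space X \<and> locally_connected_space X \<and>
     compact_space Z \<and> Hausdorff_space Z \<and> connected_space Z \<and> locally_connected_space Z \<and>
     continuous_map X Z f \<and>
     (\<forall>z\<in>topspace Z. finite {x \<in> topspace X. f x = z}) \<and>
     degree_between f (topspace X) (topspace Z) < \<infinity> \<and>
     (\<forall>z\<in>topspace Z. (\<Sum>x\<in>{x \<in> topspace X. f x = z}. local_degree X f x)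
                      = degree_between f (topspace X) (topspace Z)) \<and>
     (\<forall>x0\<in>topspace X. \<exists>U V.
        compactin X U \<and> neighborhood X x0 U \<and> compactin Z V \<and> neighborhood Z (f x0) V \<and>
        (\<forall>z\<in>V. (\<Sum>x\<in>{x \<in> U. f x = z}. local_degree X f x) = local_degree X f x0))"

definition admissible_cover :: "'a topology \<Rightarrow> 'a set set \<Rightarrow> bool" where
  "admissible_cover X \<U>0 \<longleftrightarrow>
     finite \<U>0 \<and> \<Union>\<U>0 = topspace X \<and> (\<forall>U\<in>\<U>0. openin X U \<and> connectedin X U \<and> U \<noteq> {})"

primrec pullback_cover :: "'a topology \<Rightarrow> ('a \<Rightarrow> 'a) \<Rightarrow> 'a set set \<Rightarrow> nat \<Rightarrow> 'a set set" where
  "pullback_cover X f \<U>0 0 = \<U>0"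
| "pullback_cover X f \<U>0 (Suc n) =
     (\<Union>U\<in>pullback_cover X f \<U>0 n. connected_components_of (subtopology X {x \<in> topspace X. f x \<in> U}))"

definition cxc_expansion :: "'a topology \<Rightarrow> ('a \<Rightarrow> 'a) \<Rightarrow> 'a set set \<Rightarrow> bool" where
  "cxc_expansion X f \<U>0 \<longleftrightarrow>
     (\<forall>\<V>. (\<forall>V\<in>\<V>. openin X V) \<and> \<Union>\<V> = topspace X \<longrightarrow>
        (\<exists>N. \<forall>n>N. \<forall>U\<in>pullback_cover X f \<U>0 n. \<exists>V\<in>\<V>. U \<subseteq> V))"

definition cxc_degree :: "'a topology \<Rightarrow> ('a \<Rightarrow> 'a) \<Rightarrow> 'a set set \<Rightarrow> bool" where
  "cxc_degree X f \<U>0 \<longleftrightarrow>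
     Sup {degree_between (f ^^ k) U' ((f ^^ k) ` U') | k U'.
            U' \<in> pullback_cover X f \<U>0 k \<and> (f ^^ k) ` U' \<in> \<U>0} < \<infinity>"

definition cxc_irreducibility :: "'a topology \<Rightarrow> ('a \<Rightarrow> 'a) \<Rightarrow> bool" where
  "cxc_irreducibility X f \<longleftrightarrow>
     (\<forall>W. openin X W \<and> W \<noteq> {} \<longrightarrow> (\<exists>n. (f ^^ n) ` W = topspace X))"

definition topological_cxc_wrt :: "'a topology \<Rightarrow> ('a \<Rightarrow> 'a) \<Rightarrow> 'a set set \<Rightarrow> bool" where
  "topological_cxc_wrt X f \<U>0 \<longleftrightarrow>
     compact_space X \<and> connected_space X \<and> locally_connected_space X \<and> metrizable_space X \<and>
     (\<exists>x\<in>topspace X. \<exists>y\<in>topspace X. x \<noteq> y) \<and>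
     finite_branched_covering X X f \<and> admissible_cover X \<U>0 \<and>
     cxc_expansion X f \<U>0 \<and> cxc_degree X f \<U>0 \<and> cxc_irreducibility X f"

definition topological_cxc :: "'a topology \<Rightarrow> ('a \<Rightarrow> 'a) \<Rightarrow> bool" where
  "topological_cxc X f \<longleftrightarrow> (\<exists>\<U>0. topological_cxc_wrt X f \<U>0)"

definition metrizes :: "'a topology \<Rightarrow> ('a \<Rightarrow> 'a \<Rightarrow> real) \<Rightarrow> bool" where
  "metrizes X d \<longleftrightarrow> Metric_space (topspace X) d \<and> Metric_space.mtopology (topspace X) d = X"

definition diam :: "('a \<Rightarrow> 'a \<Rightarrow> real) \<Rightarrow> 'a set \<Rightarrow> real" where
  "diam d A = (if A = {} then 0 else SUP (x,y)\<in>A \<times> A. d x y)"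

text \<open>The denominator below is a supremum of an unbounded set only if \<open>A\<close> is the whole space. On a
  space with more than one point, the expansion axiom excludes this for the members of the
  pullback covers: if the whole space is in one level, it is in all later ones. For a proper open
  subset \<open>A\<close> of a compact connected space, the quotient is at least 1, so it lies in the domain of
  the distortion functions.\<close>

definition roundness :: "'a set \<Rightarrow> ('a \<Rightarrow> 'a \<Rightarrow> real) \<Rightarrow> 'a set \<Rightarrow> 'a \<Rightarrow> real" where
  "roundness M d A a = (SUP x\<in>A. d x a) / Sup {r. Metric_space.mball M d a r \<subseteq> A}"

definition increasing_embedding :: "(real \<Rightarrow> real) \<Rightarrow> bool" where
  "increasing_embedding \<rho> \<longleftrightarrow>
     embedding_map (top_of_set {1..}) (top_of_set {1..}) \<rho> \<and> strict_mono_on {1..} \<rho>"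

definition increasing_homeomorphism :: "(real \<Rightarrow> real) \<Rightarrow> bool" where
  "increasing_homeomorphism \<delta> \<longleftrightarrow>
     homeomorphic_map (top_of_set {0..}) (top_of_set {0..}) \<delta> \<and> strict_mono_on {0..} \<delta>"

definition roundness_distortion ::
  "'a topology \<Rightarrow> ('a \<Rightarrow> 'a) \<Rightarrow> 'a set set \<Rightarrow> ('a \<Rightarrow> 'a \<Rightarrow> real) \<Rightarrow> (real \<Rightarrow> real) \<Rightarrow> (real \<Rightarrow> real) \<Rightarrow> bool" where
  "roundness_distortion X f \<U>0 d \<rho>m \<rho>p \<longleftrightarrow>
     (\<forall>n k U U' y y'.
        U \<in> pullback_cover X f \<U>0 n \<and> U' \<in> pullback_cover X f \<U>0 (n + k) \<and>
        y' \<in> U' \<and> y \<in> U \<and> (f ^^ k) ` U' = U \<and> (f ^^ k) y' = y \<longrightarrow>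
        roundness (topspace X) d U' y' < \<rho>m (roundness (topspace X) d U y) \<and>
        roundness (topspace X) d U y < \<rho>p (roundness (topspace X) d U' y'))"

definition diameter_distortion ::
  "'a topology \<Rightarrow> ('a \<Rightarrow> 'a) \<Rightarrow> 'a set set \<Rightarrow> ('a \<Rightarrow> 'a \<Rightarrow> real) \<Rightarrow> (real \<Rightarrow> real) \<Rightarrow> (real \<Rightarrow> real) \<Rightarrow> bool" where
  "diameter_distortion X f \<U>0 d \<delta>m \<delta>p \<longleftrightarrow>
     (\<forall>n0 n1 k U V U' V'.
        U \<in> pullback_cover X f \<U>0 n0 \<and> V \<in> pullback_cover X f \<U>0 n1 \<and>
        U' \<in> pullback_cover X f \<U>0 (n0 + k) \<and> V' \<in> pullback_cover X f \<U>0 (n1 + k) \<and>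
        V \<subseteq> U \<and> V' \<subseteq> U' \<and> (f ^^ k) ` U' = U \<and> (f ^^ k) ` V' = V \<longrightarrow>
        diam d V' / diam d U' < \<delta>m (diam d V / diam d U) \<and>
        diam d V / diam d U < \<delta>p (diam d V' / diam d U'))"

definition metric_cxc :: "'a topology \<Rightarrow> ('a \<Rightarrow> 'a) \<Rightarrow> ('a \<Rightarrow> 'a \<Rightarrow> real) \<Rightarrow> bool" where
  "metric_cxc X f d \<longleftrightarrow> metrizes X d \<and>
     (\<exists>\<U>0. topological_cxc_wrt X f \<U>0 \<and>
        (\<exists>\<rho>m \<rho>p \<delta>m \<delta>p.
           increasing_embedding \<rho>m \<and> increasing_embedding \<rho>p \<and>
           increasing_homeomorphism \<delta>m \<and> increasing_homeomorphism \<delta>p \<and>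
           roundness_distortion X f \<U>0 d \<rho>m \<rho>p \<and> diameter_distortion X f \<U>0 d \<delta>m \<delta>p))"

definition canonical_gauge :: "'a topology \<Rightarrow> ('a \<Rightarrow> 'a) \<Rightarrow> ('a \<Rightarrow> 'a \<Rightarrow> real) set" where
  "canonical_gauge X f = {d. metric_cxc X f d}"

definition hausdorff_premeasure ::
  "'a set \<Rightarrow> ('a \<Rightarrow> 'a \<Rightarrow> real) \<Rightarrow> real \<Rightarrow> real \<Rightarrow> 'a set \<Rightarrow> ennreal" where
  "hausdorff_premeasure M d s \<epsilon> A =
     Inf {(\<Sum>i. ennreal (diam d (C i) powr s)) | C :: nat \<Rightarrow> 'a set.
            A \<subseteq> (\<Union>i. C i) \<and>
            (\<forall>i. C i \<subseteq> M \<and> Metric_space.mbounded M d (C i) \<and> diam d (C i) \<le> \<epsilon>)}"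

definition hausdorff_measure ::
  "'a set \<Rightarrow> ('a \<Rightarrow> 'a \<Rightarrow> real) \<Rightarrow> real \<Rightarrow> 'a set \<Rightarrow> ennreal" where
  "hausdorff_measure M d s A = (SUP \<epsilon>\<in>{0<..}. hausdorff_premeasure M d s \<epsilon> A)"

text \<open>Only exponents \<open>s > 0\<close> are used, because \<open>0 powr 0 = 0\<close> would make the 0-dimensional measure
  of a point vanish. Omitting \<open>s = 0\<close> does not change the infimum. The value is \<open>\<infinity>\<close> if there
  is no such \<open>s\<close>.\<close>

definition hausdorff_dim :: "'a set \<Rightarrow> ('a \<Rightarrow> 'a \<Rightarrow> real) \<Rightarrow> ereal" where
  "hausdorff_dim M d = Inf {ereal s | s. s > 0 \<and> hausdorff_measure M d s M = 0}"

definition conformal_dim :: "'a topology \<Rightarrow> ('a \<Rightarrow> 'a) \<Rightarrow> ereal" where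
  "conformal_dim X f = (INF d\<in>canonical_gauge X f. hausdorff_dim (topspace X) d)"

end

theory Submission
  imports Defs
begin

text \<open>Every metric \<open>d\<close> of the gauge has Hausdorff dimension strictly greater than 1, so the value 1
  cannot be attained. By irreducibility and expansion a copy of the tripod can be pulled back into
  every element of every pullback cover, and the distortion axioms keep it of definite size and
  definite shape. Hence every ball \<open>B(z, r)\<close> contains a tripod of size comparable to \<open>r\<close>, up to
  finitely many additional branch points, whose number is controlled by the degree axiom.

  Measure length by 1-Lipschitz functions: a set crosses length \<open>l\<close> if some such function takes all
  values of an interval of length \<open>l\<close> on it. Inside the middle of a crossing put a tripod. Either an
  arm is almost constant for the function, and the distance from its centre yields more length than
  the arm occupies in the interval, or two arms cover a common subinterval. In both cases the
  crossing splits into separated smaller crossings of total length at least \<open>(1 + \<epsilon>) l\<close>. Iterating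
  bounds the sum of the \<open>s\<close>-th powers of the diameters of a cover from below for some \<open>s > 1\<close>.\<close>

section \<open>Antenna-like spaces\<close>

text \<open>The obstacle is the lack of arcs: lifts of an arm under iterates of a branched map are
  only known to be continua, and what remains of a crossing after a cut need not be connected. Hence
  length is read off the values of functions, a piece may change its function from one generation to
  the next, and the room of \<open>l / 8\<close> in a crossing is what lets a fresh antenna be
  placed inside. The dichotomy for a tripod is a count: if no arm is almost constant, each of the
  three leaves the level of the centre upwards or downwards, so two go the same way and share an
  interval of levels. These two may meet again over branch points, but small neighbourhoods of
  boundedly many points take up few levels, so an interval of definite length avoids them all, and
  over it the arms are separated. The exponent comes from balance: pieces of relative length at
  least \<epsilon> and total 1 + \<epsilon> do not lose s-th powers as long as (1 + \<epsilon>)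
  \<epsilon>^(s - 1) \<ge> 1, and this admits some s > 1.\<close>

context Metric_space
begin

definition one_lipschitz :: "('a \<Rightarrow> real) \<Rightarrow> bool" where
  "one_lipschitz \<phi> \<longleftrightarrow> (\<forall>x\<in>M. \<forall>y\<in>M. \<bar>\<phi> x - \<phi> y\<bar> \<le> d x y)"

text \<open>The set \<open>R\<close> contains the part of the \<open>l/8\<close>-neighbourhood of a section of \<open>\<phi>\<close> over an interval that
  lies over the same interval. The points \<open>z\<close> need not form a connected set, so a crossing can be
  cut at any level.\<close>

definition crossing :: "real \<Rightarrow> 'a set \<Rightarrow> bool" where
  "crossing l R \<longleftrightarrow> 0 < l \<and> (\<exists>\<phi> a. one_lipschitz \<phi> \<and>
     (\<forall>t\<in>{a..a + l}. \<exists>z\<in>M. \<phi> z = t \<and> (\<forall>w\<in>M. d z w \<le> l / 8 \<and> \<phi> w \<in> {a..a + l} \<longrightarrow> w \<in> R)))"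

text \<open>The two ways in which a tripod in \<open>W\<close> gains length with respect to \<open>\<phi>\<close>: an arm of small
  oscillation, or two separated arms over the same interval.\<close>

definition antenna_in :: "'a set \<Rightarrow> real \<Rightarrow> ('a \<Rightarrow> real) \<Rightarrow> bool" where
  "antenna_in W m \<phi> \<longleftrightarrow>
     (\<exists>A \<psi> L t. A \<subseteq> W \<and> one_lipschitz \<psi> \<and> m \<le> L \<and> {0..L} \<subseteq> \<psi> ` A \<and>
        (\<forall>x\<in>A. \<bar>\<phi> x - t\<bar> \<le> L / 8)) \<or>
     (\<exists>A B u L. A \<subseteq> W \<and> B \<subseteq> W \<and> m \<le> L \<and>
        {u..u + L} \<subseteq> \<phi> ` A \<and> {u..u + L} \<subseteq> \<phi> ` B \<and> (\<forall>x\<in>A. \<forall>y\<in>B. L \<le> d x y))"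

text \<open>The antenna may be chosen after \<open>\<phi>\<close>; only its fraction of the radius
  is uniform in place, scale and function.\<close>

definition antenna_like :: "real \<Rightarrow> real \<Rightarrow> bool" where
  "antenna_like \<eta> r0 \<longleftrightarrow>
     (\<forall>z\<in>M. \<forall>r\<in>{0<..r0}. \<forall>\<phi>. one_lipschitz \<phi> \<longrightarrow> antenna_in (mball z r) (\<eta> * r) \<phi>)"

lemma antenna_in_mono:
  assumes "antenna_in W m \<phi>" "W \<subseteq> W'" "m' \<le> m"
  shows "antenna_in W' m' \<phi>"
  using assms(1) unfolding antenna_in_def
proof (elim disjE exE conjE, goal_cases)
  case (1 A \<psi> L t)
  then show ?case using assms(2,3) by (intro disjI1 exI[of _ A] exI[of _ \<psi>] exI[of _ L] exI[of _ t]) auto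
next
  case (2 A B u L)
  then show ?case using assms(2,3) by (intro disjI2 exI[of _ A] exI[of _ B] exI[of _ u] exI[of _ L]) auto
qed

lemma one_lipschitzD: "one_lipschitz \<phi> \<Longrightarrow> x \<in> M \<Longrightarrow> y \<in> M \<Longrightarrow> \<bar>\<phi> x - \<phi> y\<bar> \<le> d x y"
  by (simp add: one_lipschitz_def)

lemma one_lipschitz_dist: "p \<in> M \<Longrightarrow> one_lipschitz (d p)"
  unfolding one_lipschitz_def by (metis commute mdist_reverse_triangle)

lemma one_lipschitz_uminus: "one_lipschitz \<phi> \<Longrightarrow> one_lipschitz (\<lambda>x. - \<phi> x)"
  unfolding one_lipschitz_def by (simp add: abs_minus_commute)

text \<open>The points \<open>z\<close> over the smaller interval are simply kept. The clause on the
  level of \<open>w\<close> in \<open>crossing\<close> matters here: points near \<open>z\<close>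
  but outside the smaller band are not in the new set.\<close>

lemma crossing_restrict:
  assumes "one_lipschitz \<phi>" "0 < l'" "a \<le> a'" "a' + l' \<le> a + l"
    and "\<forall>t\<in>{a..a + l}. \<exists>z\<in>M. \<phi> z = t \<and> (\<forall>w\<in>M. d z w \<le> l / 8 \<and> \<phi> w \<in> {a..a + l} \<longrightarrow> w \<in> R)"
  shows "crossing l' (R \<inter> \<phi> -` {a'..a' + l'})"
  unfolding crossing_def
proof (intro conjI exI[of _ \<phi>] exI[of _ a'] ballI)
  fix t assume t: "t \<in> {a'..a' + l'}"
  then obtain z where z: "z \<in> M" "\<phi> z = t" "\<forall>w\<in>M. d z w \<le> l / 8 \<and> \<phi> w \<in> {a..a + l} \<longrightarrow> w \<in> R"
    using assms by (meson atLeastAtMost_iff order_trans)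
  have "l' \<le> l" using assms by linarith
  with z show "\<exists>z\<in>M. \<phi> z = t \<and> (\<forall>w\<in>M. d z w \<le> l' / 8 \<and> \<phi> w \<in> {a'..a' + l'} \<longrightarrow> w \<in> R \<inter> \<phi> -` {a'..a' + l'})"
    using assms by (intro bexI[of _ z]) auto
qed (use assms in auto)

text \<open>Makes a crossing out of a mere covering of an interval by values of
  \<open>\<phi>\<close>, by adding exactly the room that \<open>crossing\<close> demands.\<close>

lemma crossing_thicken:
  assumes "one_lipschitz \<phi>" "0 < l" "A \<subseteq> M" "{a..a + l} \<subseteq> \<phi> ` A"
  shows "crossing l {w \<in> M. (\<exists>x\<in>A. d x w \<le> l / 8) \<and> \<phi> w \<in> {a..a + l}}"
  unfolding crossing_def
proof (intro conjI exI[of _ \<phi>] exI[of _ a] ballI)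
  fix t assume t: "t \<in> {a..a + l}"
  then obtain z where "z \<in> A" "\<phi> z = t" using assms by blast
  then show "\<exists>z\<in>M. \<phi> z = t \<and> (\<forall>w\<in>M. d z w \<le> l / 8 \<and> \<phi> w \<in> {a..a + l}
      \<longrightarrow> w \<in> {w \<in> M. (\<exists>x\<in>A. d x w \<le> l / 8) \<and> \<phi> w \<in> {a..a + l}})"
    using assms by (intro bexI[of _ z]) auto
qed (use assms in auto)

text \<open>Each clause has its use in the iteration: the lower bound on \<open>ls i\<close> feeds
  the power inequality, the factor 3/4 makes the recursion end, and the gap keeps a short set of a
  cover from meeting two pieces.\<close>

definition refines_to :: "real \<Rightarrow> real \<Rightarrow> 'a set \<Rightarrow> nat \<Rightarrow> (nat \<Rightarrow> real) \<Rightarrow> (nat \<Rightarrow> 'a set) \<Rightarrow> bool" where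
  "refines_to \<epsilon> l R k ls Rs \<longleftrightarrow>
     (\<forall>i<k. crossing (ls i) (Rs i) \<and> Rs i \<subseteq> R \<and> \<epsilon> * l \<le> ls i \<and> ls i \<le> 3 / 4 * l) \<and>
     (1 + \<epsilon>) * l \<le> (\<Sum>i<k. ls i) \<and>
     (\<forall>i<k. \<forall>j<i. \<forall>x\<in>Rs i. \<forall>y\<in>Rs j. \<epsilon> * l \<le> d x y)"

text \<open>Cut out the band of half-width 3L/8 around level \<open>t\<close> and put in the
  thickened arm, which lies within L/4 of that level. This loses 3L/4, gains \<open>L\<close> and
  leaves gaps of L/8. As L \<ge> \<eta> l / 16, the gaps are at least \<eta> l / 128, whence the
  constant.\<close>

lemma refinement_arm:
  assumes "one_lipschitz \<phi>" "0 < l" "z \<in> M" "\<phi> z = a + l / 2" "0 < \<eta>" "\<eta> \<le> 1"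
    and base: "\<forall>t\<in>{a..a + l}. \<exists>z\<in>M. \<phi> z = t \<and> (\<forall>w\<in>M. d z w \<le> l / 8 \<and> \<phi> w \<in> {a..a + l} \<longrightarrow> w \<in> R)"
    and zR: "\<forall>w\<in>M. d z w \<le> l / 8 \<and> \<phi> w \<in> {a..a + l} \<longrightarrow> w \<in> R"
    and RM: "R \<subseteq> M"
    and A: "A \<subseteq> mball z (l / 16)" "one_lipschitz \<psi>" "\<eta> * (l / 16) \<le> L" "{0..L} \<subseteq> \<psi> ` A"
      "\<forall>x\<in>A. \<bar>\<phi> x - t\<bar> \<le> L / 8"
  shows "\<exists>k ls Rs. refines_to (\<eta> / 128) l R k ls Rs"
proof -
  have L0: "0 < L" using assms by (smt (verit) divide_pos_pos mult_pos_pos)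
  have AM: "A \<subseteq> M" using A(1) by auto
  obtain p q where pq: "p \<in> A" "q \<in> A" "\<psi> p = 0" "\<psi> q = L"
    using A(4) L0 by (smt (verit, best) atLeastAtMost_iff image_iff subset_iff)
  have "L \<le> d p q" using one_lipschitzD[OF A(2), of p q] pq AM L0 by (simp add: subset_iff)
  also have "\<dots> \<le> d z p + d z q" using pq AM assms(3) by (metis subsetD triangle'')
  also have "\<dots> < l / 16 + l / 16" using pq A(1) by (intro add_strict_mono) auto
  finally have Ll: "L < l / 8" by simp
  have "\<bar>\<phi> z - \<phi> p\<bar> \<le> d z p" "d z p < l / 16"
    using one_lipschitzD[OF assms(1), of z p] pq A(1) AM assms(3) by auto
  then have t: "\<bar>t - (a + l / 2)\<bar> < l / 16 + L / 8" using bspec[OF A(5) pq(1)] assms(4) by linarith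
  define l1 where "l1 = t - 3 * L / 8 - a"
  define a2 where "a2 = t + 3 * L / 8"
  define l2 where "l2 = a + l - a2"
  define R0 where "R0 = {w \<in> M. (\<exists>x\<in>A. d x w \<le> L / 8) \<and> \<psi> w \<in> {0..0 + L}}"
  define R1 where "R1 = R \<inter> \<phi> -` {a..a + l1}"
  define R2 where "R2 = R \<inter> \<phi> -` {a2..a2 + l2}"
  have l12: "l / 16 \<le> l1" "l1 \<le> 3 / 4 * l" "l / 16 \<le> l2" "l2 \<le> 3 / 4 * l"
    using t Ll L0 assms(2) by (auto simp: l1_def l2_def a2_def)
  have c0: "crossing L R0" unfolding R0_def using A AM L0 by (intro crossing_thicken) auto
  have c1: "crossing l1 R1" unfolding R1_def
    by (rule crossing_restrict[OF assms(1) _ _ _ base]) (use l12 assms(2) in auto)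
  have c2: "crossing l2 R2" unfolding R2_def
    by (rule crossing_restrict[OF assms(1) _ _ _ base]) (use l12 assms(2) t Ll L0 in \<open>auto simp: a2_def l2_def\<close>)
  have R0: "w \<in> M \<and> \<bar>\<phi> w - t\<bar> \<le> L / 4 \<and> w \<in> R" if w: "w \<in> R0" for w
  proof -
    obtain x where x: "x \<in> A" "d x w \<le> L / 8" "w \<in> M" using w R0_def by auto
    have "\<bar>\<phi> x - \<phi> w\<bar> \<le> d x w" using x AM by (intro one_lipschitzD[OF assms(1)]) auto
    then have 1: "\<bar>\<phi> w - t\<bar> \<le> L / 4" using bspec[OF A(5) x(1)] x(2) by linarith
    \<comment> \<open>The radius l/16 of the ball plus the thickening L/8 < l/64 stays within the
      room l/8 around \<open>z\<close>.\<close>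
    have "d z w \<le> d z x + d x w" using x AM by (intro triangle assms(3)) auto
    moreover have "d z x < l / 16" using x A(1) by auto
    ultimately have 2: "d z w \<le> l / 8" using x Ll assms(2) by linarith
    have "a \<le> \<phi> w \<and> \<phi> w \<le> a + l" using 1 t Ll assms(2) by linarith
    then have "\<phi> w \<in> {a..a + l}" by simp
    then show ?thesis using 1 2 x zR by auto
  qed
  have sep: "L / 8 \<le> d x y" if "\<bar>\<phi> x - \<phi> y\<bar> \<ge> L / 8" "x \<in> M" "y \<in> M" for x y
    using that one_lipschitzD[OF assms(1)] by fastforce
  have s10: "L / 8 \<le> d x y" if "x \<in> R1" "y \<in> R0" for x y
    using that R0[of y] RM unfolding R1_def l1_def by (intro sep) (auto simp: abs_if split: if_splits)
  have s20: "L / 8 \<le> d x y" if "x \<in> R2" "y \<in> R0" for x y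
    using that R0[of y] RM unfolding R2_def l2_def a2_def by (intro sep) (auto simp: abs_if split: if_splits)
  have s21: "L / 8 \<le> d x y" if "x \<in> R2" "y \<in> R1" for x y
    using that L0 RM unfolding R2_def l2_def a2_def R1_def l1_def by (intro sep) (auto simp: abs_if split: if_splits)
  have e: "\<eta> / 128 * l \<le> L / 8" using A(3) by simp
  have e': "\<eta> * l \<le> l" using assms(2,6) by simp
  obtain \<delta> where \<delta>: "\<delta> = \<eta> / 128 * l" by blast
  have \<delta>l: "\<delta> \<le> L" "\<delta> \<le> l1" "\<delta> \<le> l2"
    unfolding \<delta> using e e' L0 l12 by linarith+
  obtain \<gamma> where \<gamma>: "\<gamma> = L / 8" by blast
  show ?thesis
  proof (intro exI)
    show "refines_to (\<eta> / 128) l R 3 (\<lambda>i. [L, l1, l2] ! i) (\<lambda>i. [R0, R1, R2] ! i)"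
      unfolding refines_to_def
    proof (intro conjI allI impI)
      show "(1 + \<eta> / 128) * l \<le> (\<Sum>i<3. [L, l1, l2] ! i)"
        using e L0 by (simp add: eval_nat_numeral l1_def l2_def a2_def algebra_simps)
      fix i :: nat assume "i < 3"
      then have i: "i = 0 \<or> i = 1 \<or> i = 2" by auto
      show "crossing ([L, l1, l2] ! i) ([R0, R1, R2] ! i)" using i c0 c1 c2 by auto
      show "[R0, R1, R2] ! i \<subseteq> R" using i R0 by (auto simp: R1_def R2_def)
      show "\<eta> / 128 * l \<le> [L, l1, l2] ! i" using i \<delta>l unfolding \<delta>[symmetric] by auto
      show "[L, l1, l2] ! i \<le> 3 / 4 * l" using i l12 Ll assms(2) by auto
      fix j assume "j < i"
      with i have "i = 1 \<and> j = 0 \<or> i = 2 \<and> j = 0 \<or> i = 2 \<and> j = 1"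
        by auto
      then have "\<forall>x\<in>[R0, R1, R2] ! i. \<forall>y\<in>[R0, R1, R2] ! j. \<gamma> \<le> d x y"
        by (elim disjE) (simp_all add: s10[folded \<gamma>] s20[folded \<gamma>] s21[folded \<gamma>])
      with e \<gamma> show "\<forall>x\<in>[R0, R1, R2] ! i. \<forall>y\<in>[R0, R1, R2] ! j. \<eta> / 128 * l \<le> d x y"
        by (metis order_trans)
    qed
  qed
qed

text \<open>Two thickened arms over the same interval gain 2L. The removed band reaches L/4 beyond
  the interval on both sides and costs 3L/2, so L/2 is won. The thickenings stay apart because each
  uses up only L/8 of the distance \<open>L\<close> between the arms.\<close>

lemma refinement_doubling:
  assumes "one_lipschitz \<phi>" "0 < l" "z \<in> M" "\<phi> z = a + l / 2" "0 < \<eta>" "\<eta> \<le> 1"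
    and base: "\<forall>t\<in>{a..a + l}. \<exists>z\<in>M. \<phi> z = t \<and> (\<forall>w\<in>M. d z w \<le> l / 8 \<and> \<phi> w \<in> {a..a + l} \<longrightarrow> w \<in> R)"
    and zR: "\<forall>w\<in>M. d z w \<le> l / 8 \<and> \<phi> w \<in> {a..a + l} \<longrightarrow> w \<in> R"
    and RM: "R \<subseteq> M"
    and A: "A \<subseteq> mball z (l / 16)" "B \<subseteq> mball z (l / 16)" "\<eta> * (l / 16) \<le> L"
      "{u..u + L} \<subseteq> \<phi> ` A" "{u..u + L} \<subseteq> \<phi> ` B" "\<forall>x\<in>A. \<forall>y\<in>B. L \<le> d x y"
  shows "\<exists>k ls Rs. refines_to (\<eta> / 128) l R k ls Rs"
proof -
  have L0: "0 < L" using assms by (smt (verit) divide_pos_pos mult_pos_pos)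
  have AM: "A \<subseteq> M" "B \<subseteq> M" using A by auto
  obtain p q where pq: "p \<in> A" "q \<in> A" "\<phi> p = u" "\<phi> q = u + L"
    using A(4) L0 by (smt (verit, best) atLeastAtMost_iff image_iff subset_iff)
  have "\<bar>\<phi> z - \<phi> p\<bar> \<le> d z p" "d z p < l / 16"
    using one_lipschitzD[OF assms(1), of z p] pq A(1) AM assms(3) by auto
  then have u1: "a + l / 2 - l / 16 < u" using pq(3) assms(4) by auto
  have "\<bar>\<phi> z - \<phi> q\<bar> \<le> d z q" "d z q < l / 16"
    using one_lipschitzD[OF assms(1), of z q] pq A(1) AM assms(3) by auto
  then have u2: "u + L < a + l / 2 + l / 16" using pq(4) assms(4) by auto
  have Ll: "L < l / 8" using u1 u2 by simp
  define l1 where "l1 = u - L / 4 - a"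
  define a2 where "a2 = u + 5 * L / 4"
  define l2 where "l2 = a + l - a2"
  define N where "N = (\<lambda>A. {w \<in> M. (\<exists>x\<in>A. d x w \<le> L / 8) \<and> \<phi> w \<in> {u..u + L}})"
  define R1 where "R1 = R \<inter> \<phi> -` {a..a + l1}"
  define R2 where "R2 = R \<inter> \<phi> -` {a2..a2 + l2}"
  have l12: "l / 16 \<le> l1" "l1 \<le> 3 / 4 * l" "l / 16 \<le> l2" "l2 \<le> 3 / 4 * l"
    using u1 u2 Ll L0 assms(2) unfolding l1_def l2_def a2_def by argo+
  have cA: "crossing L (N A)" "crossing L (N B)"
    unfolding N_def by (rule crossing_thicken[OF assms(1) L0]; fact)+
  have c1: "crossing l1 R1" unfolding R1_def
    by (rule crossing_restrict[OF assms(1) _ _ _ base]) (use l12 assms(2) in auto)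
  have c2: "crossing l2 R2" unfolding R2_def
    by (rule crossing_restrict[OF assms(1) _ _ _ base]) (use l12 assms(2) u1 u2 Ll L0 in \<open>auto simp: a2_def l2_def\<close>)
  have N: "w \<in> R" if w: "w \<in> N C" and C: "C \<subseteq> mball z (l / 16)" for w C
  proof -
    obtain x where x: "x \<in> C" "d x w \<le> L / 8" "w \<in> M" using w N_def by auto
    have "d z w \<le> d z x + d x w" using x C by (intro triangle assms(3)) auto
    moreover have "d z x < l / 16" using x C by auto
    ultimately have 2: "d z w \<le> l / 8" using x Ll assms(2) by linarith
    have "\<phi> w \<in> {a..a + l}" using w u1 u2 Ll L0 by (auto simp: N_def)
    then show ?thesis using 2 x zR by auto
  qed
  have sep: "L / 8 \<le> d x y" if "\<bar>\<phi> x - \<phi> y\<bar> \<ge> L / 8" "x \<in> M" "y \<in> M" for x y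
    using that one_lipschitzD[OF assms(1)] by fastforce
  have s10: "L / 8 \<le> d x y" if "x \<in> R1" "y \<in> N C" for x y C
    using that L0 RM unfolding R1_def l1_def by (intro sep) (auto simp: N_def abs_if split: if_splits)
  have s20: "L / 8 \<le> d x y" if "x \<in> R2" "y \<in> N C" for x y C
    using that L0 RM unfolding R2_def l2_def a2_def by (intro sep) (auto simp: N_def abs_if split: if_splits)
  have s21: "L / 8 \<le> d x y" if "x \<in> R2" "y \<in> R1" for x y
    using that L0 RM unfolding R2_def l2_def a2_def R1_def l1_def by (intro sep) (auto simp: abs_if split: if_splits)
  have sAB: "L / 8 \<le> d y x" if x: "x \<in> N A" and y: "y \<in> N B" for x y
  proof -
    obtain x' where x': "x' \<in> A" "d x' x \<le> L / 8" "x \<in> M" using x N_def by auto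
    obtain y' where y': "y' \<in> B" "d y' y \<le> L / 8" "y \<in> M" using y N_def by auto
    have "L \<le> d x' y'" using x' y' A(6) by auto
    also have "\<dots> \<le> d x' x + d x y'" using x' y' AM by (auto intro: triangle)
    also have "d x y' \<le> d x y + d y' y" using x' y' AM by (auto intro: triangle')
    finally show ?thesis using x' y' L0 commute[of x y] by linarith
  qed
  have e: "\<eta> / 128 * l \<le> L / 8" using A(3) by simp
  have e': "\<eta> * l \<le> l" using assms(2,6) by simp
  obtain \<delta> where \<delta>: "\<delta> = \<eta> / 128 * l" by blast
  have \<delta>l: "\<delta> \<le> L" "\<delta> \<le> l1" "\<delta> \<le> l2"
    unfolding \<delta> using e e' L0 l12 by linarith+
  obtain \<gamma> where \<gamma>: "\<gamma> = L / 8" by blast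
  show ?thesis
  proof (intro exI)
    show "refines_to (\<eta> / 128) l R 4 (\<lambda>i. [L, L, l1, l2] ! i) (\<lambda>i. [N A, N B, R1, R2] ! i)"
      unfolding refines_to_def
    proof (intro conjI allI impI)
      show "(1 + \<eta> / 128) * l \<le> (\<Sum>i<4. [L, L, l1, l2] ! i)"
        using e L0 by (simp add: eval_nat_numeral l1_def l2_def a2_def algebra_simps)
      fix i :: nat assume "i < 4"
      then have i: "i = 0 \<or> i = 1 \<or> i = 2 \<or> i = 3" by auto
      show "crossing ([L, L, l1, l2] ! i) ([N A, N B, R1, R2] ! i)" using i cA c1 c2 by (auto simp: numeral_3_eq_3)
      show "[N A, N B, R1, R2] ! i \<subseteq> R" using i N[OF _ A(1)] N[OF _ A(2)] by (auto simp: R1_def R2_def numeral_3_eq_3)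
      show "\<eta> / 128 * l \<le> [L, L, l1, l2] ! i"
        using i \<delta>l unfolding \<delta>[symmetric] by (auto simp: numeral_3_eq_3)
      show "[L, L, l1, l2] ! i \<le> 3 / 4 * l" using i l12 Ll assms(2) by (auto simp: numeral_3_eq_3)
      fix j assume "j < i"
      with i have "i = 1 \<and> j = 0 \<or> i = 2 \<and> j = 0 \<or> i = 2 \<and> j = 1 \<or> i = 3 \<and> j = 0 \<or> i = 3 \<and> j = 1 \<or> i = 3 \<and> j = 2"
        by auto
      then have "\<forall>x\<in>[N A, N B, R1, R2] ! i. \<forall>y\<in>[N A, N B, R1, R2] ! j. \<gamma> \<le> d x y"
        by (elim disjE) (simp_all add: numeral_3_eq_3 s10[folded \<gamma>] s20[folded \<gamma>] s21[folded \<gamma>] sAB[folded \<gamma>])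
      with e \<gamma> show "\<forall>x\<in>[N A, N B, R1, R2] ! i. \<forall>y\<in>[N A, N B, R1, R2] ! j. \<eta> / 128 * l \<le> d x y"
        by (metis order_trans)
    qed
  qed
qed

lemma antenna_refinement:
  assumes "antenna_like \<eta> r0" "0 < \<eta>" "\<eta> \<le> 1" "crossing l R" "R \<subseteq> M" "l \<le> r0"
  shows "\<exists>k ls Rs. refines_to (\<eta> / 128) l R k ls Rs"
proof -
  obtain \<phi> a where l: "0 < l" and \<phi>: "one_lipschitz \<phi>"
    and base: "\<forall>t\<in>{a..a + l}. \<exists>z\<in>M. \<phi> z = t \<and> (\<forall>w\<in>M. d z w \<le> l / 8 \<and> \<phi> w \<in> {a..a + l} \<longrightarrow> w \<in> R)"
    using assms(4) unfolding crossing_def by auto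
  \<comment> \<open>The middle level keeps the antenna away from both ends, so that two long
    remnants of the old crossing survive.\<close>
  obtain z where z: "z \<in> M" "\<phi> z = a + l / 2"
     "\<forall>w\<in>M. d z w \<le> l / 8 \<and> \<phi> w \<in> {a..a + l} \<longrightarrow> w \<in> R"
    using bspec[OF base, of "a + l / 2"] l by auto
  have "l / 16 \<in> {0<..r0}" using l assms(6) by auto
  from assms(1)[unfolded antenna_like_def, rule_format, OF z(1) this \<phi>, unfolded antenna_in_def]
  show ?thesis
  proof (elim disjE exE conjE)
    fix A \<psi> L t
    assume "A \<subseteq> mball z (l/16)" "one_lipschitz \<psi>" "\<eta> * (l/16) \<le> L" "{0..L} \<subseteq> \<psi> ` A"
      "\<forall>x\<in>A. \<bar>\<phi> x - t\<bar> \<le> L / 8"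
    then show ?thesis by (rule refinement_arm[OF \<phi> l z(1,2) assms(2,3) base z(3) assms(5)])
  next
    fix A B u L
    assume "A \<subseteq> mball z (l/16)" "B \<subseteq> mball z (l/16)" "\<eta> * (l/16) \<le> L"
      "{u..u + L} \<subseteq> \<phi> ` A" "{u..u + L} \<subseteq> \<phi> ` B" "\<forall>x\<in>A. \<forall>y\<in>B. L \<le> d x y"
    then show ?thesis by (rule refinement_doubling[OF \<phi> l z(1,2) assms(2,3) base z(3) assms(5)])
  qed
qed

end

text \<open>For y in [\<epsilon>, 1] one has y^t \<ge> y^s \<ge> \<epsilon>^(s - 1) y, which is
  linear in y and can be summed; the total 1 + \<epsilon> then compensates the factor \<epsilon>^(s
  - 1).\<close>

lemma powr_sum_ge_of_sum_ge:
  fixes \<epsilon> s t l :: real and x :: "'i \<Rightarrow> real"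
  assumes "0 < \<epsilon>" "0 < t" "t \<le> s" "1 \<le> s" "1 \<le> (1 + \<epsilon>) * \<epsilon> powr (s - 1)" "0 < l"
    and "\<And>i. i \<in> I \<Longrightarrow> \<epsilon> * l \<le> x i \<and> x i \<le> l" "(1 + \<epsilon>) * l \<le> (\<Sum>i\<in>I. x i)"
  shows "l powr t \<le> (\<Sum>i\<in>I. x i powr t)"
proof -
  have *: "l powr t * (\<epsilon> powr (s - 1) * (x i / l)) \<le> x i powr t" if "i \<in> I" for i
  proof -
    define y where "y = x i / l"
    have y: "\<epsilon> \<le> y" "y \<le> 1" using assms(7)[OF that] \<open>0 < l\<close> by (auto simp: y_def field_simps)
    have "\<epsilon> powr (s - 1) * y \<le> y powr (s - 1) * y powr 1"
      using y assms by (intro mult_mono powr_mono2) auto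
    also have "\<dots> = y powr s" unfolding powr_add[symmetric] by simp
    also have "\<dots> \<le> y powr t" using y assms by (intro powr_mono') auto
    finally have "l powr t * (\<epsilon> powr (s - 1) * y) \<le> l powr t * y powr t"
      by (intro mult_left_mono) auto
    also have "\<dots> = (l * y) powr t" using y assms by (simp add: powr_mult)
    also have "l * y = x i" using \<open>0 < l\<close> by (simp add: y_def)
    finally show ?thesis by (simp add: y_def)
  qed
  have "l powr t * 1 \<le> l powr t * ((1 + \<epsilon>) * \<epsilon> powr (s - 1))"
    using assms by (intro mult_left_mono) auto
  also have "\<dots> \<le> l powr t * (((\<Sum>i\<in>I. x i) / l) * \<epsilon> powr (s - 1))"
    using assms by (intro mult_left_mono mult_right_mono) (auto simp: field_simps)
  also have "\<dots> = (\<Sum>i\<in>I. l powr t * (\<epsilon> powr (s - 1) * (x i / l)))"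
    by (simp add: sum_distrib_left sum_divide_distrib sum_distrib_right mult_ac)
  also have "\<dots> \<le> (\<Sum>i\<in>I. x i powr t)" using * by (rule sum_mono)
  finally show ?thesis by simp
qed

section \<open>Lower bounds for covers of a crossing\<close>

context Metric_space
begin

lemma crossing_nonempty: 
  assumes "crossing l R" shows "R \<noteq> {}"
proof -
  obtain \<phi> a where l: "0 < l"
    and base: "\<forall>t\<in>{a..a + l}. \<exists>z\<in>M. \<phi> z = t \<and> (\<forall>w\<in>M. d z w \<le> l / 8 \<and> \<phi> w \<in> {a..a + l} \<longrightarrow> w \<in> R)"
    using assms unfolding crossing_def by auto
  obtain z where z: "z \<in> M" "\<phi> z = a"
     "\<forall>w\<in>M. d z w \<le> l / 8 \<and> \<phi> w \<in> {a..a + l} \<longrightarrow> w \<in> R"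
    using bspec[OF base, of a] l by auto
  have "z \<in> R" using z l by simp
  then show ?thesis by auto
qed

text \<open>If all sets of the cover are shorter than the gaps between the smaller crossings, none of them
  meets two of these, and the estimates for the smaller crossings can be added. The number \<open>m\<close>
  makes the recursion stop.\<close>

lemma crossing_content:
  assumes "antenna_like \<eta> r0" "0 < \<eta>" "\<eta> \<le> 1" and \<epsilon>: "\<epsilon> = \<eta> / 128"
    and st: "0 < t" "t \<le> s" "1 \<le> s" "1 \<le> (1 + \<epsilon>) * \<epsilon> powr (s - 1)"
    and "0 < m"
  shows "crossing l R \<Longrightarrow> R \<subseteq> M \<Longrightarrow> l \<le> r0 \<Longrightarrow> finite J \<Longrightarrow> R \<subseteq> (\<Union>j\<in>J. C j) \<Longrightarrow>
    (\<And>j x y. j \<in> J \<Longrightarrow> x \<in> C j \<Longrightarrow> y \<in> C j \<Longrightarrow> d x y \<le> w j) \<Longrightarrow> (\<And>j. j \<in> J \<Longrightarrow> m \<le> w j) \<Longrightarrow>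
    \<epsilon> * l \<le> (4/3) ^ n * m \<Longrightarrow> (\<epsilon> * l) powr t \<le> (\<Sum>j\<in>J. w j powr t)"
proof (induction n arbitrary: l R J)
  have \<epsilon>0: "0 < \<epsilon>" using assms by auto
  \<comment> \<open>The factor \<open>\<epsilon>\<close> in the bound is made for this case: one set
    of size at least \<open>\<epsilon> * l\<close> already pays for the whole crossing.\<close>
  have big: "(\<epsilon> * l) powr t \<le> (\<Sum>j\<in>J. w j powr t)"
    if "finite J" "j \<in> J" "\<epsilon> * l \<le> w j" "0 < l" for J j l
  proof -
    have "(\<epsilon> * l) powr t \<le> w j powr t" using that \<epsilon>0 st by (intro powr_mono2) auto
    also have "\<dots> \<le> (\<Sum>j\<in>J. w j powr t)" using that by (intro member_le_sum) auto
    finally show ?thesis .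
  qed
  {
    case 0
    obtain j where "j \<in> J" using crossing_nonempty[OF 0(1)] 0 by blast
    moreover have "0 < l" using 0(1) by (simp add: crossing_def)
    ultimately show ?case using 0(4) 0(7)[of j] 0(8) by (intro big[of J j]) auto
  next
    case (Suc n)
    have l: "0 < l" using Suc.prems(1) by (simp add: crossing_def)
    show ?case
    proof (cases "\<exists>j\<in>J. \<epsilon> * l \<le> w j")
      case True
      then show ?thesis using Suc.prems(4) l by (auto intro: big)
    next
      case False
      obtain k ls Rs where ref: "refines_to \<epsilon> l R k ls Rs"
        using antenna_refinement[OF assms(1-3) Suc.prems(1-3)] \<epsilon> by auto
      define K where "K i = {j\<in>J. C j \<inter> Rs i \<noteq> {}}" for i
      have IH: "(\<epsilon> * ls i) powr t \<le> (\<Sum>j\<in>K i. w j powr t)" if i: "i < k" for i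
      proof (rule Suc.IH)
        have ri: "crossing (ls i) (Rs i)" "Rs i \<subseteq> R" "ls i \<le> 3 / 4 * l" 
          using ref i by (auto simp: refines_to_def)
        show "crossing (ls i) (Rs i)" by fact
        show "Rs i \<subseteq> M" using ri Suc.prems by auto
        show "ls i \<le> r0" using ri l Suc.prems by auto
        show "finite (K i)" using Suc.prems by (auto simp: K_def)
        show "Rs i \<subseteq> (\<Union>j\<in>K i. C j)" using ri Suc.prems(5) by (fastforce simp: K_def)
        \<comment> \<open>The pieces are shorter by the factor 3/4, which cancels one of the factors
          4/3.\<close>
        have "\<epsilon> * ls i \<le> \<epsilon> * (3 / 4 * l)" using ri \<epsilon>0 by (intro mult_left_mono) auto
        then show "\<epsilon> * ls i \<le> (4/3) ^ n * m" using Suc.prems(8) by simp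
      qed (use Suc.prems in \<open>auto simp: K_def\<close>)
      have disj: "K i \<inter> K i' = {}" if "i < k" "i' < i" for i i'
      proof (rule ccontr)
        assume "K i \<inter> K i' \<noteq> {}"
        then obtain j x y where j: "j \<in> J" "x \<in> C j" "x \<in> Rs i" "y \<in> C j" "y \<in> Rs i'"
          by (auto simp: K_def)
        have "\<epsilon> * l \<le> d x y" using ref that j by (simp add: refines_to_def)
        also have "\<dots> \<le> w j" using Suc.prems(6) j by simp
        finally show False using False j by auto
      qed
      have "l powr t \<le> (\<Sum>i<k. ls i powr t)"
        using ref l by (intro powr_sum_ge_of_sum_ge[OF \<epsilon>0 st l]) (auto simp: refines_to_def)
      then have "(\<epsilon> * l) powr t \<le> \<epsilon> powr t * (\<Sum>i<k. ls i powr t)"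
        using \<epsilon>0 l by (simp add: powr_mult)
      also have "\<dots> = (\<Sum>i<k. (\<epsilon> * ls i) powr t)"
      proof -
        have "(\<epsilon> * ls i) powr t = \<epsilon> powr t * ls i powr t" if "i < k" for i
          using ref that \<epsilon>0 by (auto simp: refines_to_def crossing_def powr_mult)
        then show ?thesis by (simp add: sum_distrib_left)
      qed
      also have "\<dots> \<le> (\<Sum>i<k. \<Sum>j\<in>K i. w j powr t)" using IH by (intro sum_mono) auto
      also have "\<dots> = (\<Sum>j\<in>(\<Union>i<k. K i). w j powr t)"
      proof (rule sum.UNION_disjoint[symmetric])
        show "\<forall>i\<in>{..<k}. \<forall>j\<in>{..<k}. i \<noteq> j \<longrightarrow> K i \<inter> K j = {}"
          using disj by (metis Int_commute lessThan_iff linorder_neqE_nat)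
      qed (use Suc.prems in \<open>auto simp: K_def\<close>)
      also have "\<dots> \<le> (\<Sum>j\<in>J. w j powr t)"
        using Suc.prems by (intro sum_mono2) (auto simp: K_def)
      finally show ?thesis .
    qed
  }
qed

section \<open>Diameters, Lipschitz images and the dimension bound\<close>

lemma diam_upper:
  assumes "mbounded A" "x \<in> A" "y \<in> A"
  shows "d x y \<le> diam d A"
proof -
  obtain B where "\<forall>x\<in>A. \<forall>y\<in>A. d x y \<le> B" using assms(1) by (auto simp: mbounded_alt)
  then have "bdd_above ((\<lambda>(x, y). d x y) ` (A \<times> A))" by (intro bdd_aboveI[of _ B]) auto
  then have "(\<lambda>(x, y). d x y) (x, y) \<le> (SUP (x,y)\<in>A \<times> A. d x y)"
    using assms by (intro cSUP_upper) auto
  then show ?thesis using assms by (auto simp: diam_def)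
qed

lemma diam_least:
  assumes "A \<noteq> {}" "\<And>x y. x \<in> A \<Longrightarrow> y \<in> A \<Longrightarrow> d x y \<le> c"
  shows "diam d A \<le> c"
  using assms unfolding diam_def by (auto intro!: cSUP_least)

lemma diam_nonneg: "mbounded A \<Longrightarrow> 0 \<le> diam d A"
  by (metis all_not_in_conv diam_def diam_upper nonneg order.trans order_refl)

lemma diam_mono: "mbounded B \<Longrightarrow> A \<subseteq> B \<Longrightarrow> diam d A \<le> diam d B"
  by (metis diam_def diam_least diam_nonneg diam_upper subsetD)

lemma one_lipschitz_continuous_map:
  assumes "one_lipschitz \<phi>" shows "continuous_map mtopology euclideanreal \<phi>"
proof -
  interpret E: Metric_space UNIV "dist :: real \<Rightarrow> real \<Rightarrow> real" by (rule Met_TC.Metric_space_axioms)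
  have "continuous_map mtopology Met_TC.mtopology \<phi>"
    unfolding metric_continuous_map[OF Met_TC.Metric_space_axioms]
  proof (intro conjI ballI allI impI)
    fix a e assume "a \<in> M" "0 < (e::real)"
    then show "\<exists>\<delta>>0. \<forall>x. x \<in> M \<and> d a x < \<delta> \<longrightarrow> dist (\<phi> a) (\<phi> x) < e"
      using assms by (intro exI[of _ e]) (force simp: one_lipschitz_def dist_real_def)
  qed auto
  then show ?thesis by simp
qed

lemma one_lipschitz_connected_image:
  assumes "one_lipschitz \<phi>" "connectedin mtopology A" "x \<in> A" "y \<in> A"
  shows "{\<phi> x..\<phi> y} \<subseteq> \<phi> ` A"
proof -
  have "connectedin euclideanreal (\<phi> ` A)"
    using connectedin_continuous_map_image[OF one_lipschitz_continuous_map[OF assms(1)] assms(2)] .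
  then have "connected (\<phi> ` A)" by simp
  then show ?thesis using assms connected_contains_Icc by blast
qed

text \<open>The estimate for crossings takes finitely many sets with sizes bounded below, while
  Hausdorff covers are countable and may contain points. So each set is fattened to an open one at a
  summable price, and compactness selects finitely many.\<close>

theorem hausdorff_dim_gt_one:
  assumes ant: "antenna_like \<eta> r0" "0 < \<eta>" "\<eta> \<le> 1" and "0 < r0"
    and comp: "compact_space mtopology" and conn: "connected_space mtopology"
    and p: "p \<in> M" "q \<in> M" "p \<noteq> q"
  shows "1 < hausdorff_dim M d"
proof -
  define \<epsilon> where "\<epsilon> = \<eta> / 128"
  \<comment> \<open>The solution of (1 + \<epsilon>) \<epsilon>^(s - 1) = 1.\<close>
  define s where "s = 1 + ln (1 + \<epsilon>) / ln (1 / \<epsilon>)"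
  have \<epsilon>: "0 < \<epsilon>" "\<epsilon> < 1" using ant by (auto simp: \<epsilon>_def)
  have s1: "1 < s" using \<epsilon> by (auto simp: s_def)
  have "(s - 1) * ln \<epsilon> = - ln (1 + \<epsilon>)" using \<epsilon> by (simp add: s_def ln_div)
  then have "\<epsilon> powr (s - 1) = inverse (1 + \<epsilon>)" using \<epsilon> by (simp add: powr_def exp_minus)
  then have s: "1 \<le> (1 + \<epsilon>) * \<epsilon> powr (s - 1)" using \<epsilon> by simp
  define l where "l = min r0 (d p q)"
  have l: "0 < l" "l \<le> r0" using assms by (auto simp: l_def)
  \<comment> \<open>The first crossing: by connectedness the distance from \<open>p\<close> takes
    all values up to \<open>d p q\<close>.\<close>
  have "{d p p..d p q} \<subseteq> d p ` M"
    using conn p by (intro one_lipschitz_connected_image one_lipschitz_dist)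
      (auto simp: connectedin_topspace[of mtopology, simplified])
  then have "{0..0 + l} \<subseteq> d p ` M" using p by (auto simp: l_def)
  from crossing_thicken[OF one_lipschitz_dist[OF p(1)] l(1) order_refl this]
  have "crossing l {w \<in> M. (\<exists>x\<in>M. d x w \<le> l / 8) \<and> d p w \<in> {0..0 + l}}" .
  then obtain R where R: "crossing l R" "R \<subseteq> M" by blast
  have key: "s < t" if t: "0 < t" "hausdorff_measure M d t M = 0" for t
  proof (rule ccontr)
    assume "\<not> s < t"
    then have ts: "t \<le> s" by simp
    define c where "c = (\<epsilon> * l) powr t"
    have c: "0 < c" using \<epsilon> l by (simp add: c_def)
    have "hausdorff_premeasure M d t 1 M \<le> hausdorff_measure M d t M"
      unfolding hausdorff_measure_def by (rule SUP_upper) auto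
    then have "hausdorff_premeasure M d t 1 M < ennreal (c / 2)" using t c by (simp add: ennreal_zero_less_divide)
    then obtain C :: "nat \<Rightarrow> 'a set" where sumC: "(\<Sum>i. ennreal (diam d (C i) powr t)) < ennreal (c / 2)"
      and C: "M \<subseteq> (\<Union>i. C i)" "\<And>i. C i \<subseteq> M" "\<And>i. mbounded (C i)"
      unfolding hausdorff_premeasure_def Inf_less_iff by blast
    \<comment> \<open>The added terms sum to at most c/4, so together with \<open>sumC\<close> the
      total stays below c. They also make \<open>v i\<close> positive and larger than the diameter
      for sets of diameter 0.\<close>
    define v where "v i = (diam d (C i) powr t + c * (1/2) ^ (i + 3)) powr (1 / t)" for i
    have vt: "v i powr t = diam d (C i) powr t + c * (1/2) ^ (i + 3)" for i
      using t c by (simp add: v_def powr_powr add_nonneg_nonneg)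
    have v: "diam d (C i) < v i" for i
    proof -
      have "diam d (C i) = (diam d (C i) powr t) powr (1 / t)" using t diam_nonneg[OF C(3), of i] by (simp add: powr_powr)
      also have "\<dots> < v i" unfolding v_def using t c by (intro powr_less_mono2) auto
      finally show ?thesis .
    qed
    \<comment> \<open>Each of two points of \<open>G i\<close> uses half of the slack, so their
      distance is at most \<open>v i\<close>.\<close>
    define G where "G i = (\<Union>x\<in>C i. mball x ((v i - diam d (C i)) / 2))" for i
    have "compactin mtopology M" using comp by (simp add: compact_space_def)
    moreover have "openin mtopology (G i)" for i unfolding G_def by auto
    moreover have "M \<subseteq> (\<Union>i. G i)"
    proof
      fix x assume x: "x \<in> M"
      then obtain i where "x \<in> C i" using C by auto
      then have "x \<in> G i" using v[of i] x by (auto simp: G_def intro!: bexI[of _ x])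
      then show "x \<in> (\<Union>i. G i)" by auto
    qed
    ultimately obtain \<F> where \<F>: "finite \<F>" "\<F> \<subseteq> range G" "M \<subseteq> \<Union>\<F>"
      unfolding compactin_def by (metis (no_types, opaque_lifting) imageE)
    then obtain J where J: "finite J" "\<F> = G ` J" by (meson finite_subset_image)
    have Od: "d x y \<le> v i" if xy_G: "x \<in> G i" "y \<in> G i" for x y i
    proof -
      obtain x' y' where xy: "x' \<in> C i" "d x' x < (v i - diam d (C i)) / 2" "x \<in> M"
         "y' \<in> C i" "d y' y < (v i - diam d (C i)) / 2" "y \<in> M" using xy_G unfolding G_def UN_iff in_mball by blast
      have "x' \<in> M" "y' \<in> M" using xy C by auto
      then have "d x y \<le> d x' x + d x' y" "d x' y \<le> d x' y' + d y' y" using xy by (auto intro: triangle triangle'')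
      then show ?thesis using xy diam_upper[OF C(3) xy(1) xy(4)] by argo
    qed
    have Jne: "J \<noteq> {}" using \<F> J p by auto
    define m where "m = Min (v ` J)"
    have v0: "0 < v i" for i using v[of i] diam_nonneg[OF C(3), of i] by linarith
    have m: "0 < m" "\<And>j. j \<in> J \<Longrightarrow> m \<le> v j" using J Jne v0 by (auto simp: m_def)
    obtain n where "\<epsilon> * l / m < (4/3::real) ^ n" using real_arch_pow[of "4/3"] by auto
    then have n: "\<epsilon> * l \<le> (4/3) ^ n * m" using m(1) by (simp add: field_simps)
    have "R \<subseteq> (\<Union>j\<in>J. G j)" using R \<F> J by auto
    from crossing_content[OF ant \<epsilon>_def t(1) ts _ s m(1) R l(2) J(1) this Od m(2) n]
    have "c \<le> (\<Sum>j\<in>J. v j powr t)" using s1 by (simp add: c_def)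
    also have "\<dots> = (\<Sum>j\<in>J. diam d (C j) powr t) + c * (\<Sum>j\<in>J. (1/2) ^ (j + 3))"
      by (simp add: vt sum.distrib sum_distrib_left)
    also have "(\<Sum>j\<in>J. diam d (C j) powr t) < c / 2"
    proof -
      have "ennreal (\<Sum>j\<in>J. diam d (C j) powr t) = (\<Sum>j\<in>J. ennreal (diam d (C j) powr t))"
        by (simp add: sum_ennreal)
      also have "\<dots> \<le> (\<Sum>i. ennreal (diam d (C i) powr t))" using J by (intro sum_le_suminf) auto
      finally show ?thesis using sumC by (metis ennreal_less_iff le_less_trans sum_nonneg powr_ge_zero)
    qed
    also have "(\<Sum>j\<in>J. (1/2::real) ^ (j + 3)) \<le> (\<Sum>j. (1/2) ^ (j + 3))"
      using J by (intro sum_le_suminf) (auto simp: power_add intro!: summable_mult2)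
    also have "\<dots> = 1/4"
    proof -
      have "(\<lambda>j. (1/2::real) ^ j * (1/8)) sums (2 * (1/8))"
        using geometric_sums[of "1/2::real"] by (intro sums_mult2) simp
      then show ?thesis by (simp add: power_add power3_eq_cube sums_iff)
    qed
    finally show False using c by simp
  qed
  have "ereal s \<le> hausdorff_dim M d" unfolding hausdorff_dim_def using key by (intro Inf_greatest) (auto intro: less_imp_le)
  moreover have "1 < ereal s" using s1 by simp
  ultimately show ?thesis by (rule less_le_trans[rotated])
qed

end

section \<open>Finite branched coverings\<close>

text \<open>Every neighbourhood contains \<open>x\<close> itself. Finiteness of the fibres is
  essential, since \<open>card\<close> is 0 on infinite sets.\<close>

lemma local_degree_ge_1:
  assumes "continuous_map X Z f" "\<And>z. z \<in> topspace Z \<Longrightarrow> finite {x \<in> topspace X. f x = z}" "x \<in> topspace X"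
  shows "1 \<le> local_degree X f x"
  unfolding local_degree_def
proof (rule INF_greatest)
  fix U assume "U \<in> {U. neighborhood X x U}"
  then have U: "U \<subseteq> topspace X" "x \<in> U" by (auto simp: neighborhood_def dest: subsetD[OF interior_of_subset])
  have "f x \<in> topspace Z" using continuous_map_image_subset_topspace[OF assms(1)] assms(3) by blast
  then have "finite {y \<in> U. f y = f x}" using U by (intro finite_subset[OF _ assms(2)[of "f x"]]) auto
  moreover have "{y \<in> U. f y = f x} \<noteq> {}" using U by auto
  ultimately have "1 \<le> card {y \<in> U. f y = f x}" by (simp add: Suc_leI card_gt_0_iff)
  then have "1 \<le> enat (card {y \<in> U. f y = f x})" by (simp add: one_enat_def)
  also have "\<dots> \<le> degree_between f U (f ` U)" unfolding degree_between_def using U by (intro SUP_upper) auto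
  finally show "1 \<le> degree_between f U (f ` U)" .
qed

text \<open>An empty fibre would make the sum in (i), and hence the degree, equal to 0, whereas any
  nonempty fibre has at least one point.\<close>

lemma fbc_surj:
  assumes fbc: "finite_branched_covering X Z f" and "topspace X \<noteq> {}"
  shows "f ` topspace X = topspace Z"
proof
  show "f ` topspace X \<subseteq> topspace Z"
    using fbc by (simp add: finite_branched_covering_def continuous_map_image_subset_topspace)
  show "topspace Z \<subseteq> f ` topspace X"
  proof (rule ccontr)
    assume "\<not> topspace Z \<subseteq> f ` topspace X"
    then obtain z where z: "z \<in> topspace Z" "z \<notin> f ` topspace X" by auto
    then have e: "{x \<in> topspace X. f x = z} = {}" by auto
    have "degree_between f (topspace X) (topspace Z) = (\<Sum>x\<in>{x \<in> topspace X. f x = z}. local_degree X f x)"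
      using fbc z unfolding finite_branched_covering_def by simp
    then have deg0: "degree_between f (topspace X) (topspace Z) = 0" unfolding e by simp
    obtain x where x: "x \<in> topspace X" using assms(2) by blast
    then have fx: "f x \<in> topspace Z" using \<open>f ` topspace X \<subseteq> topspace Z\<close> by auto
    then have "finite {y \<in> topspace X. f y = f x}" using fbc by (simp add: finite_branched_covering_def)
    moreover have "{y \<in> topspace X. f y = f x} \<noteq> {}" using x by auto
    ultimately have "0 < enat (card {y \<in> topspace X. f y = f x})" 
      by (simp add: card_gt_0_iff zero_enat_def)
    also have "\<dots> \<le> degree_between f (topspace X) (topspace Z)"
      unfolding degree_between_def using fx by (intro SUP_upper) auto
    finally show False using deg0 by simp
  qed
qed

text \<open>The local degrees are at least 1, so condition (ii) makes \<open>x0\<close> the only point of its fibre in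
  \<open>U\<close>. By compactness nearby fibres meet every neighbourhood of \<open>x0\<close>.\<close>

lemma fbc_open_map:
  assumes fbc: "finite_branched_covering X Z f"
  shows "open_map X Z f"
  unfolding open_map_def
proof (intro allI impI)
  fix W assume W: "openin X W"
  have cont: "continuous_map X Z f" and fin: "\<And>z. z \<in> topspace Z \<Longrightarrow> finite {x \<in> topspace X. f x = z}"
    and H: "Hausdorff_space Z" using fbc by (simp_all add: finite_branched_covering_def)
  show "openin Z (f ` W)"
  proof (subst openin_subopen, intro ballI)
    fix z assume "z \<in> f ` W"
    then obtain x0 where x0: "x0 \<in> W" "z = f x0" by auto
    then have x0X: "x0 \<in> topspace X" using W openin_subset by blast
    then obtain U V where U: "compactin X U" "neighborhood X x0 U" and V: "neighborhood Z (f x0) V"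
      and sum: "\<And>z. z \<in> V \<Longrightarrow> (\<Sum>x\<in>{x \<in> U. f x = z}. local_degree X f x) = local_degree X f x0"
      using fbc unfolding finite_branched_covering_def by meson
    have UX: "U \<subseteq> topspace X" and x0U: "x0 \<in> U" and VZ: "V \<subseteq> topspace Z" and fV: "f x0 \<in> V"
      using U V by (auto simp: neighborhood_def dest: subsetD[OF interior_of_subset])
    \<comment> \<open>Finiteness is needed to cancel below, because \<infinity> + 1 = \<infinity> in
      \<open>enat\<close>.\<close>
    have "local_degree X f x0 \<le> degree_between f (topspace X) (f ` topspace X)"
      unfolding local_degree_def using x0X by (intro INF_lower) (auto simp: neighborhood_def)
    also have "\<dots> \<le> degree_between f (topspace X) (topspace Z)"
      unfolding degree_between_def 
      using continuous_map_image_subset_topspace[OF cont] by (intro SUP_subset_mono) blast+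
    also have "\<dots> < \<infinity>" using fbc by (simp add: finite_branched_covering_def)
    finally have ld: "local_degree X f x0 < \<infinity>" .
    have iso: "x = x0" if "x \<in> U" "f x = f x0" for x
    proof (rule ccontr)
      assume "x \<noteq> x0"
      have "local_degree X f x0 + 1 \<le> local_degree X f x0 + local_degree X f x"
        using local_degree_ge_1[OF cont fin] that UX by (intro add_left_mono) auto
      also have "\<dots> = (\<Sum>x\<in>{x0, x}. local_degree X f x)" using \<open>x \<noteq> x0\<close> by simp
      also have "\<dots> \<le> (\<Sum>x\<in>{x \<in> U. f x = f x0}. local_degree X f x)"
      proof (rule sum_mono2)
        show "finite {x \<in> U. f x = f x0}"
          using UX VZ fV by (intro finite_subset[OF _ fin[of "f x0"]]) auto
      qed (use that x0U in auto)
      also have "\<dots> = local_degree X f x0" using sum fV by simp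
      finally show False using ld by (cases "local_degree X f x0") (auto simp: one_enat_def)
    qed
    define N where "N = Z interior_of V - f ` (U - W)"
    have "U - W = U \<inter> (topspace X - W)" using UX by auto
    then have "compactin X (U - W)" using compact_Int_closedin[OF U(1) closedin_diff[OF closedin_topspace W]] by simp
    then have "closedin Z (f ` (U - W))" by (rule compactin_imp_closedin[OF H image_compactin[OF _ cont]])
    then have "openin Z N" unfolding N_def by (intro openin_diff) auto
    moreover have "z \<in> N" using V x0 iso by (auto simp: N_def neighborhood_def)
    moreover have "N \<subseteq> f ` W"
    proof
      fix y assume y: "y \<in> N"
      then have yV: "y \<in> V" by (auto simp: N_def dest: subsetD[OF interior_of_subset])
      have "(\<Sum>x\<in>{x \<in> U. f x = y}. local_degree X f x) \<noteq> 0"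
        using sum[OF yV] local_degree_ge_1[OF cont fin x0X] by auto
      then have "{x \<in> U. f x = y} \<noteq> {}" by (metis sum.empty)
      then obtain x where "x \<in> U" "f x = y" by blast
      then show "y \<in> f ` W" using y by (auto simp: N_def)
    qed
    ultimately show "\<exists>T. openin Z T \<and> z \<in> T \<and> T \<subseteq> f ` W" by auto
  qed
qed

text \<open>The image of \<open>C\<close> is open, and it is also closed in \<open>U\<close>: the
  closure of \<open>C\<close> is compact, and its points over \<open>U\<close> belong to
  \<open>C\<close>, which is closed in the preimage. Connectedness of \<open>U\<close> does the
  rest.\<close>

lemma open_map_component_onto:
  assumes X: "compact_space X" "locally_connected_space X" and Z: "Hausdorff_space Z"
    and g: "continuous_map X Z g" "open_map X Z g"
    and U: "openin Z U" "connectedin Z U"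
    and C: "C \<in> connected_components_of (subtopology X {x \<in> topspace X. g x \<in> U})"
  shows "openin X C" "connectedin X C" "C \<noteq> {}" "g ` C = U"
proof -
  let ?P = "{x \<in> topspace X. g x \<in> U}"
  have P: "openin X ?P" using g U by (simp add: openin_continuous_map_preimage)
  show oC: "openin X C" using X(2) C P locally_connected_space_open_connected_components by blast
  show cC: "connectedin X C" using C connectedin_connected_components_of connectedin_subtopology by blast
  show neC: "C \<noteq> {}" using C nonempty_connected_components_of by blast
  have CP: "C \<subseteq> ?P" using connected_components_of_subset[OF C] by auto
  have "closedin (subtopology X ?P) C" using C by (rule closedin_connected_components_of)
  then obtain T where T: "closedin X T" "C = T \<inter> ?P" unfolding closedin_subtopology by auto
  let ?K = "X closure_of C"
  have KT: "?K \<subseteq> T" using T by (intro closure_of_minimal) auto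
  have CK: "C \<subseteq> ?K" by (rule closure_of_subset[OF openin_subset[OF oC]])
  have KX: "?K \<subseteq> topspace X" by (rule closure_of_subset_topspace)
  have "compactin X ?K" using X by (simp add: closedin_compact_space)
  then have "closedin Z (g ` ?K)" by (rule compactin_imp_closedin[OF Z image_compactin[OF _ g(1)]])
  then have o2: "openin Z (topspace Z - g ` ?K)" by auto
  have o1: "openin Z (g ` C)" using g oC by (simp add: open_map_def)
  have eq: "U \<inter> g ` ?K = g ` C"
  proof
    show "U \<inter> g ` ?K \<subseteq> g ` C"
    proof
      fix y assume "y \<in> U \<inter> g ` ?K"
      then obtain c where c: "c \<in> ?K" "y = g c" "g c \<in> U" by blast
      then have "c \<in> C" using KT KX T(2) by blast
      then show "y \<in> g ` C" using c by blast
    qed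
    show "g ` C \<subseteq> U \<inter> g ` ?K" using CP CK by blast
  qed
  have "U \<inter> (topspace Z - g ` ?K) = {}"
  proof (rule ccontr)
    assume ne: "U \<inter> (topspace Z - g ` ?K) \<noteq> {}"
    have "U \<subseteq> topspace Z" using U openin_subset by blast
    then have "U \<subseteq> g ` C \<union> (topspace Z - g ` ?K)" "g ` C \<inter> (topspace Z - g ` ?K) \<inter> U = {}" "g ` C \<inter> U \<noteq> {}"
      using eq neC CK by blast+
    then show False using U(2) o1 o2 ne unfolding connectedin by blast
  qed
  then show "g ` C = U" using eq openin_subset[OF U(1)] by blast
qed

lemma open_map_continuum_component_onto:
  assumes X: "compact_space X" "Hausdorff_space X" and Z: "Hausdorff_space Z"
    and g: "continuous_map X Z g" "open_map X Z g"
    and K: "compactin Z K" "connectedin Z K" and x: "x \<in> topspace X" "g x \<in> K"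
  obtains C where "compactin X C" "connectedin X C" "x \<in> C" "g ` C = K"
proof -
  let ?P = "{x \<in> topspace X. g x \<in> K}"
  let ?Y = "subtopology X ?P"
  let ?C = "connected_component_of_set ?Y x"
  have "closedin X ?P" by (rule closedin_continuous_map_preimage[OF g(1) compactin_imp_closedin[OF Z K(1)]])
  then have cP: "compactin X ?P" using X closedin_compact_space by blast
  have tY: "topspace ?Y = ?P" by auto
  have Y: "compact_space ?Y" "Hausdorff_space ?Y"
    using cP X by (auto simp: compact_space_subtopology Hausdorff_space_subtopology)
  have xY: "x \<in> topspace ?Y" using x by auto
  have C: "?C \<in> connected_components_of ?Y" using xY by (simp only: connected_component_in_connected_components_of)
  have closC: "closedin ?Y ?C" by (rule closedin_connected_component_of)
  then have compY: "compactin ?Y ?C" using Y closedin_compact_space by blast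
  have CP: "?C \<subseteq> ?P" using connected_components_of_subset[OF C] by auto
  have xC: "x \<in> ?C" using xY by (simp add: connected_component_of_refl)
  have "K \<subseteq> g ` ?C"
  proof (rule ccontr)
    assume "\<not> K \<subseteq> g ` ?C"
    then obtain y where y: "y \<in> K" "y \<notin> g ` ?C" by auto
    define F where "F = {p \<in> ?P. g p = y}"
    have yZ: "y \<in> topspace Z" using y K compactin_subset_topspace by blast
    have "closedin X {p \<in> topspace X. g p \<in> {y}}"
      using g Z yZ by (intro closedin_continuous_map_preimage[of X Z]) (auto simp: closedin_Hausdorff_sing_eq)
    then have "closedin ?Y ({p \<in> topspace X. g p \<in> {y}} \<inter> ?P)" unfolding closedin_subtopology by blast
    also have "{p \<in> topspace X. g p \<in> {y}} \<inter> ?P = F" by (auto simp: F_def)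
    finally have "closedin ?Y F" .
    moreover have "disjnt ?C F" using y by (auto simp: disjnt_def F_def)
    moreover have "locally_compact_space ?Y" using Y compact_imp_locally_compact_space by blast
    ultimately have "separated_between ?Y ?C F"
      using Y C compY by (intro separated_between_compact_connected_component) auto
    then obtain A B where AB: "openin ?Y A" "openin ?Y B" "A \<union> B = topspace ?Y" "disjnt A B" "?C \<subseteq> A" "F \<subseteq> B"
      unfolding separated_between_def by blast
    have op: "open_map ?Y (subtopology Z K) g" by (rule open_map_restriction[OF g(2)]) auto
    have "openin (subtopology Z K) (g ` A)" using op AB by (simp add: open_map_def)
    moreover have "closedin (subtopology Z K) (g ` A)"
    proof (rule compactin_imp_closedin)
      show "Hausdorff_space (subtopology Z K)" using Z by (rule Hausdorff_space_subtopology)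
      have "A = topspace ?Y - B" using AB by (auto simp: disjnt_def)
      then have "closedin ?Y A" using closedin_diff[OF closedin_topspace AB(2)] by metis
      then have "compactin ?Y A" using Y closedin_compact_space by blast
      moreover have "continuous_map ?Y (subtopology Z K) g"
        using g by (auto simp: continuous_map_in_subtopology continuous_map_from_subtopology)
      ultimately show "compactin (subtopology Z K) (g ` A)" by (rule image_compactin)
    qed
    moreover have "connected_space (subtopology Z K)" using K by (simp add: connectedin_def)
    moreover have "g ` A \<noteq> {}" using AB xC by auto
    ultimately have "g ` A = topspace (subtopology Z K)" using connected_space_clopen_in by blast
    then have "y \<in> g ` A" using y yZ by auto
    then obtain p where p: "p \<in> A" "g p = y" by auto
    moreover have "A \<subseteq> ?P" using AB(1) openin_subset tY by metis
    ultimately have "p \<in> F" by (auto simp: F_def)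
    then show False using p AB by (auto simp: disjnt_def)
  qed
  then have "g ` ?C = K" using CP by auto
  moreover have "connectedin X ?C"
    using connectedin_connected_component_of[of ?Y x] unfolding connectedin_subtopology by blast
  moreover have "compactin X ?C" using compY by (simp add: compactin_subtopology)
  ultimately show thesis using that xC by blast
qed

section \<open>Pullback covers\<close>

lemma connected_open_two_points:
  assumes "Hausdorff_space X" "connected_space X" "openin X U" "U \<noteq> {}"
    and "x \<in> topspace X" "y \<in> topspace X" "x \<noteq> y"
  shows "\<exists>a\<in>U. \<exists>b\<in>U. a \<noteq> b"
proof (rule ccontr)
  assume *: "\<not> ?thesis"
  obtain a where "a \<in> U" using assms(4) by auto
  then have U: "U = {a}" using * by auto
  have "a \<in> topspace X" using \<open>a \<in> U\<close> openin_subset[OF assms(3)] by auto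
  then have "closedin X U" using assms(1) by (simp add: U closedin_Hausdorff_sing_eq)
  then have "U = topspace X" using assms connected_space_clopen_in by blast
  then have "x = a" "y = a" using assms U by blast+
  then show False using assms by simp
qed

lemma image_funpow_Suc: "(f ^^ Suc n) ` A = f ` (f ^^ n) ` A" "(f ^^ Suc n) ` A = (f ^^ n) ` f ` A"
  by (simp_all only: image_comp flip: funpow.simps(2) funpow_Suc_right)

locale topological_cxc_system =
  fixes X :: "'a topology" and f :: "'a \<Rightarrow> 'a" and \<U>0 :: "'a set set"
  assumes top_cxc: "topological_cxc_wrt X f \<U>0"
begin

abbreviation M where "M \<equiv> topspace X"
abbreviation \<U> where "\<U> \<equiv> pullback_cover X f \<U>0"

lemma fbc: "finite_branched_covering X X f"
  using top_cxc by (simp add: topological_cxc_wrt_def)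

lemma X_space: "compact_space X" "Hausdorff_space X" "connected_space X" "locally_connected_space X"
  using fbc by (simp_all add: finite_branched_covering_def)

lemma two_points: obtains x y where "x \<in> M" "y \<in> M" "x \<noteq> y"
  using top_cxc by (auto simp: topological_cxc_wrt_def)

lemma f_map: "continuous_map X X f" "open_map X X f" "f ` M = M"
proof -
  show "continuous_map X X f" using fbc by (simp add: finite_branched_covering_def)
  show "open_map X X f" by (rule fbc_open_map[OF fbc])
  have "M \<noteq> {}" using two_points by blast
  then show "f ` M = M" by (rule fbc_surj[OF fbc])
qed

lemma f_finite_fibre: "finite {x \<in> M. f x = z}"
proof (cases "z \<in> M")
  case True then show ?thesis using fbc by (simp add: finite_branched_covering_def)
next
  case False
  then have "{x \<in> M. f x = z} = {}" using f_map(3) by auto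
  then show ?thesis by (metis finite.emptyI)
qed

lemma iter_continuous: "continuous_map X X (f ^^ n)"
proof (induction n)
  case (Suc n) then show ?case using continuous_map_compose[OF Suc f_map(1)] by (simp only: funpow.simps(2))
qed (simp add: id_def[symmetric])

lemma iter_open: "open_map X X (f ^^ n)"
proof (induction n)
  case (Suc n) then show ?case using open_map_compose[OF Suc f_map(2)] by (simp only: funpow.simps(2))
qed (simp add: open_map_def)

lemma iter_surj: "(f ^^ n) ` M = M"
  by (induction n) (simp_all add: image_funpow_Suc(1) f_map(3) del: funpow.simps(2))

lemma iter_in: "x \<in> M \<Longrightarrow> (f ^^ n) x \<in> M"
  using iter_surj by blast

lemma iter_finite_fibre: "finite {x \<in> M. (f ^^ n) x = z}"
proof (induction n arbitrary: z)
  case 0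
  have "{x \<in> M. (f ^^ 0) x = z} \<subseteq> {z}" by auto
  then show ?case using finite_subset by blast
next
  case (Suc n)
  have "{x \<in> M. (f ^^ Suc n) x = z} \<subseteq> (\<Union>y\<in>{y \<in> M. f y = z}. {x \<in> M. (f ^^ n) x = y})"
    using iter_in by auto
  then show ?case using Suc f_finite_fibre by (meson finite_UN_I finite_subset)
qed

lemma cover_element: 
  assumes "U \<in> \<U> n" shows "openin X U" "connectedin X U" "U \<noteq> {}"
proof -
  have "U \<in> \<U> n \<Longrightarrow> openin X U \<and> connectedin X U \<and> U \<noteq> {}" for U
  proof (induction n arbitrary: U)
    case 0 then show ?case using top_cxc by (simp add: topological_cxc_wrt_def admissible_cover_def)
  next
    case (Suc n)
    then obtain V where V: "V \<in> \<U> n" "U \<in> connected_components_of (subtopology X {x \<in> M. f x \<in> V})" by auto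
    then show ?case
      using open_map_component_onto[OF X_space(1,4,2) f_map(1,2) _ _ V(2)] Suc.IH by blast
  qed
  then show "openin X U" "connectedin X U" "U \<noteq> {}" using assms by auto
qed

lemma cover_element_subset: "U \<in> \<U> n \<Longrightarrow> U \<subseteq> M"
  using cover_element(1) openin_subset by blast

lemma cover_SucE:
  assumes "U \<in> \<U> (Suc n)"
  obtains "f ` U \<in> \<U> n" "U \<in> connected_components_of (subtopology X {x \<in> M. f x \<in> f ` U})"
proof -
  obtain V where V: "V \<in> \<U> n" "U \<in> connected_components_of (subtopology X {x \<in> M. f x \<in> V})" using assms by auto
  then have "f ` U = V"
    using open_map_component_onto[OF X_space(1,4,2) f_map(1,2) _ _ V(2)] cover_element by blast
  then show thesis using that V by auto
qed

lemma cover_image: "U \<in> \<U> (n + k) \<Longrightarrow> (f ^^ k) ` U \<in> \<U> n"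
proof (induction k arbitrary: U)
  case (Suc k)
  then have "f ` U \<in> \<U> (n + k)" by (metis add_Suc_right cover_SucE)
  from Suc.IH[OF this] show ?case by (simp only: image_funpow_Suc(2))
qed simp

text \<open>Elements of the covers are components at each single step; this is the same property for
  \<open>k\<close> steps together. It reduces inclusions between elements to inclusions between
  their images.\<close>

lemma cover_maximal:
  assumes "U \<in> \<U> (n + k)" "connectedin X A" "A \<inter> U \<noteq> {}" "(f ^^ k) ` A \<subseteq> (f ^^ k) ` U"
  shows "A \<subseteq> U"
  using assms
proof (induction k arbitrary: U A)
  case (Suc k)
  obtain U': "f ` U \<in> \<U> (n + k)" "U \<in> connected_components_of (subtopology X {x \<in> M. f x \<in> f ` U})"
    using cover_SucE[of U "n + k"] Suc.prems(1) by auto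
  have "f ` A \<subseteq> f ` U"
  proof (rule Suc.IH[OF U'(1)])
    show "connectedin X (f ` A)" using f_map(1) Suc.prems(2) by (rule connectedin_continuous_map_image)
    show "f ` A \<inter> f ` U \<noteq> {}" using Suc.prems(3) by auto
    show "(f ^^ k) ` (f ` A) \<subseteq> (f ^^ k) ` (f ` U)"
      using Suc.prems(4) by (simp only: image_funpow_Suc(2))
  qed
  then have "A \<subseteq> {x \<in> M. f x \<in> f ` U}" using connectedin_subset_topspace[OF Suc.prems(2)] by auto
  then have "connectedin (subtopology X {x \<in> M. f x \<in> f ` U}) A" using Suc.prems(2) by (simp add: connectedin_subtopology)
  then show ?case using connected_components_of_maximal[OF U'(2)] Suc.prems(3) by (auto simp: disjnt_def)
qed auto

text \<open>At each step take the component of the given point. By \<open>cover_maximal\<close> the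
  lift through \<open>x\<close> is unique.\<close>

lemma cover_lift:
  assumes "V \<in> \<U> q" "x \<in> M" "(f ^^ n) x \<in> V"
  obtains V' where "V' \<in> \<U> (q + n)" "x \<in> V'" "(f ^^ n) ` V' = V"
proof -
  have "\<exists>V'. V' \<in> \<U> (q + n) \<and> x \<in> V' \<and> (f ^^ n) ` V' = V"
    using assms(2,3)
  proof (induction n arbitrary: x)
    case 0 then show ?case using assms(1) by auto
  next
    case (Suc n)
    have "f x \<in> M" using Suc.prems f_map(3) by auto
    then obtain W where W: "W \<in> \<U> (q + n)" "f x \<in> W" "(f ^^ n) ` W = V"
      using Suc.IH[of "f x"] Suc.prems by (auto simp: funpow_swap1)
    let ?P = "{x \<in> M. f x \<in> W}"
    let ?C = "connected_component_of_set (subtopology X ?P) x"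
    have xP: "x \<in> topspace (subtopology X ?P)" using Suc.prems W by auto
    then have C: "?C \<in> connected_components_of (subtopology X ?P)"
      by (simp only: connected_component_in_connected_components_of)
    have "f ` ?C = W"
      using open_map_component_onto(4)[OF X_space(1,4,2) f_map(1,2) _ _ C] cover_element W(1) by blast
    then have "(f ^^ Suc n) ` ?C = V"
      using W(3) by (simp only: image_funpow_Suc(2))
    moreover have "?C \<in> \<U> (q + Suc n)" using C W(1) by auto
    moreover have "x \<in> ?C" using xP by (simp add: connected_component_of_refl)
    ultimately show ?case by blast
  qed
  then show thesis using that by blast
qed

lemma cover_covers: "\<Union>(\<U> n) = M"
proof
  show "\<Union>(\<U> n) \<subseteq> M" using cover_element_subset by blast
  show "M \<subseteq> \<Union>(\<U> n)"
  proof
    fix x assume x: "x \<in> M"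
    have "\<Union>\<U>0 = M" using top_cxc by (simp add: topological_cxc_wrt_def admissible_cover_def)
    then obtain V where "V \<in> \<U> 0" "(f ^^ n) x \<in> V" using iter_in[OF x, of n] by auto
    then show "x \<in> \<Union>(\<U> n)" using cover_lift[of V 0 x n] x by auto
  qed
qed

text \<open>Components of the preimage of \<open>V\<close> are disjoint and map onto
  \<open>V\<close>, so each takes its own point from the finite fibre over one fixed
  \<open>v\<close>.\<close>

lemma finite_cover: "finite (\<U> n)"
proof (induction n)
  case 0 then show ?case using top_cxc by (simp add: topological_cxc_wrt_def admissible_cover_def)
next
  case (Suc n)
  have "finite (connected_components_of (subtopology X {x \<in> M. f x \<in> V}))" if V: "V \<in> \<U> n" for V
  proof -
    let ?Q = "connected_components_of (subtopology X {x \<in> M. f x \<in> V})"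
    obtain v where v: "v \<in> V" using cover_element V by blast
    have "\<exists>x. x \<in> C \<and> f x = v \<and> x \<in> M" if C: "C \<in> ?Q" for C
      using open_map_component_onto[OF X_space(1,4,2) f_map(1,2) cover_element(1,2)[OF V] C] v openin_subset by blast
    then obtain g where g: "\<And>C. C \<in> ?Q \<Longrightarrow> g C \<in> C \<and> f (g C) = v \<and> g C \<in> M" by metis
    have "inj_on g ?Q"
      using g connected_components_of_overlap by (metis (no_types, lifting) IntI empty_iff inj_onI)
    moreover have "g ` ?Q \<subseteq> {x \<in> M. f x = v}" using g by auto
    ultimately show ?thesis using f_finite_fibre[of v] by (meson inj_on_finite)
  qed
  then show ?case using Suc by simp
qed

text \<open>Expansion for the open cover by the complements of \<open>K\<close> and
  \<open>L\<close>. The form with \<open>eventually\<close> allows several requirements to be met at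
  a common level.\<close>

lemma expansion_separates:
  assumes "closedin X K" "closedin X L" "K \<inter> L = {}"
  shows "\<forall>\<^sub>F n in sequentially. \<forall>V\<in>\<U> n. V \<inter> K = {} \<or> V \<inter> L = {}"
proof -
  have "\<exists>N. \<forall>n>N. \<forall>U\<in>\<U> n. \<exists>V\<in>{M - K, M - L}. U \<subseteq> V"
  proof -
    have "(\<forall>V\<in>{M - K, M - L}. openin X V) \<and> \<Union>{M - K, M - L} = M" using assms by auto
    then show ?thesis
      using top_cxc unfolding topological_cxc_wrt_def cxc_expansion_def by blast
  qed
  then obtain N where N: "\<forall>n>N. \<forall>U\<in>\<U> n. \<exists>V\<in>{M - K, M - L}. U \<subseteq> V" by blast
  show ?thesis unfolding eventually_sequentially
    using N by (intro exI[of _ "Suc N"]) (force simp: Suc_le_eq)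
qed

text \<open>The whole space would lift to itself at every later level, although late elements cannot
  contain two given points. This keeps the inradius in \<open>roundness\<close> bounded.\<close>

lemma space_notin_cover: "M \<notin> \<U> n"
proof
  assume "M \<in> \<U> n"
  then have "M \<in> \<U> (n + k)" for k
  proof (induction k)
    case (Suc k)
    then obtain x where x: "x \<in> M" using cover_element(3) by blast
    obtain V' where V': "V' \<in> \<U> (n + k + 1)" "x \<in> V'" "(f ^^ 1) ` V' = M"
      using cover_lift[OF Suc.IH[OF Suc.prems] x iter_in[OF x, of 1]] by blast
    have "M \<subseteq> V'"
    proof (rule cover_maximal[OF V'(1)])
      show "connectedin X M" using X_space by (simp add: connectedin_topspace)
    qed (use V' x iter_surj[of 1] in auto)
    then show ?case using V'(1) cover_element_subset[OF V'(1)] by (simp add: subset_antisym del: pullback_cover.simps)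
  qed simp
  obtain x y where xy: "x \<in> M" "y \<in> M" "x \<noteq> y" by (rule two_points)
  then have "\<forall>\<^sub>F n in sequentially. \<forall>V\<in>\<U> n. V \<inter> {x} = {} \<or> V \<inter> {y} = {}"
    using X_space by (intro expansion_separates) (auto simp: closedin_Hausdorff_sing_eq)
  then obtain N where N: "\<forall>m\<ge>N. \<forall>V\<in>\<U> m. V \<inter> {x} = {} \<or> V \<inter> {y} = {}" unfolding eventually_sequentially by blast
  have "M \<inter> {x} = {} \<or> M \<inter> {y} = {}" using N[rule_format, of "n + N" M] \<open>\<And>k. M \<in> \<U> (n + k)\<close> by simp
  then show False using xy by auto
qed

text \<open>The point is uniformity in \<open>k\<close>: it bounds the number of lifted branch
  points inside an element of any level.\<close>

lemma degree_bound:
  obtains p :: nat where "\<And>k U z. U \<in> \<U> k \<Longrightarrow> card {x \<in> U. (f ^^ k) x = z} \<le> p"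
proof -
  let ?S = "{degree_between (f ^^ k) U' ((f ^^ k) ` U') | k U'. U' \<in> \<U> k \<and> (f ^^ k) ` U' \<in> \<U>0}"
  have "Sup ?S < \<infinity>" using top_cxc by (simp add: topological_cxc_wrt_def cxc_degree_def)
  then obtain p where p: "Sup ?S = enat p" by (rule less_infinityE)
  have "card {x \<in> U. (f ^^ k) x = z} \<le> p" if U: "U \<in> \<U> k" for k U z
  proof (cases "z \<in> (f ^^ k) ` U")
    case True
    have "(f ^^ k) ` U \<in> \<U>0" using cover_image[of U 0 k] U by simp
    then have "degree_between (f ^^ k) U ((f ^^ k) ` U) \<in> ?S" using U by blast
    then have "degree_between (f ^^ k) U ((f ^^ k) ` U) \<le> enat p" unfolding p[symmetric] by (rule Sup_upper)
    moreover have "enat (card {x \<in> U. (f ^^ k) x = z}) \<le> degree_between (f ^^ k) U ((f ^^ k) ` U)"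
      unfolding degree_between_def using True by (rule SUP_upper)
    ultimately show ?thesis by (metis enat_ord_simps(1) order_trans)
  next
    case False
    then have "{x \<in> U. (f ^^ k) x = z} = {}" by auto
    then show ?thesis by (simp only: card.empty)
  qed
  then show thesis using that by blast
qed

text \<open>The lift of \<open>V\<close> through \<open>y\<close> maps onto \<open>V\<close>, so it
  contains a point \<open>x\<close> over \<open>a\<close>; being the lift through \<open>x\<close>
  too, it lies in \<open>W x\<close>.\<close>

lemma fibre_neighbourhoods_cover:
  assumes U: "U \<in> \<U> n" and V: "V \<in> \<U> q" "a \<in> V" "V \<subseteq> (f ^^ n) ` U"
    and W: "\<And>x. x \<in> U \<Longrightarrow> (f ^^ n) x = a \<Longrightarrow> W x \<in> \<U> (q + n) \<and> x \<in> W x \<and> (f ^^ n) ` W x = V"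
    and y: "y \<in> U" "(f ^^ n) y \<in> V"
  obtains x where "x \<in> U" "(f ^^ n) x = a" "y \<in> W x"
proof -
  have "y \<in> M" using y cover_element_subset[OF U] by auto
  then obtain V' where V': "V' \<in> \<U> (q + n)" "y \<in> V'" "(f ^^ n) ` V' = V"
    using cover_lift[OF V(1) _ y(2)] by blast
  have "V' \<subseteq> U"
    using cover_maximal[of U 0 n V'] U V'  V(3) y cover_element(2) by auto
  moreover obtain x where x: "x \<in> V'" "(f ^^ n) x = a" using V' V(2) by (metis imageE)
  ultimately have "x \<in> U" by auto
  then have Wx: "W x \<in> \<U> (q + n)" "x \<in> W x" "(f ^^ n) ` W x = V" using W x by auto
  then have "V' \<subseteq> W x"
    using cover_maximal[OF Wx(1), of V'] V' x cover_element(2) by auto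
  then show thesis using that[of x] \<open>x \<in> U\<close> x V' by auto
qed

end

section \<open>Tripods\<close>

text \<open>Keeps of the tripod what can be lifted: three nondegenerate continua that meet at most
  in the centre. Shortening the arms puts them into any given neighbourhood.\<close>

lemma tripod_arms:
  fixes X :: "'a topology"
  assumes "S \<subseteq> topspace X" "top_of_set tripod homeomorphic_space subtopology X S"
  obtains p where "p \<in> topspace X"
    "\<And>W. openin X W \<Longrightarrow> p \<in> W \<Longrightarrow> \<exists>S :: nat \<Rightarrow> 'a set.
       (\<forall>i<3. compactin X (S i) \<and> connectedin X (S i) \<and> p \<in> S i \<and> S i \<subseteq> W \<and> (\<exists>b\<in>S i. b \<noteq> p)) \<and>
       (\<forall>i<3. \<forall>j<i. S i \<inter> S j \<subseteq> {p})"
proof -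
  obtain h g where hg: "homeomorphic_maps (top_of_set tripod) (subtopology X S) h g"
    using assms(2) unfolding homeomorphic_space_def by blast
  then have cont: "continuous_map (top_of_set tripod) X h"
    by (simp add: homeomorphic_maps_def continuous_map_in_subtopology)
  have inj: "inj_on h tripod" using hg by (auto simp: homeomorphic_maps_def intro!: inj_on_inverseI)
  define e :: "nat \<Rightarrow> real^3" where "e i = [axis 1 1, axis 2 1, axis 3 1] ! i" for i
  define arm where "arm t i = closed_segment 0 (t *\<^sub>R e i)" for t i
  have i3: "i = 0 \<or> i = 1 \<or> i = 2" if "i < 3" for i :: nat using that by auto
  have arm1: "arm 1 i \<subseteq> tripod" if "i < 3" for i
    using i3[OF that] by (auto simp: arm_def e_def tripod_def)
  have arm_sub: "arm t i \<subseteq> arm 1 i" if "0 < t" "t \<le> 1" for t i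
  proof -
    have "t *\<^sub>R e i \<in> closed_segment 0 (e i)" using that by (auto simp: in_segment intro!: exI[of _ t])
    then show ?thesis by (simp add: arm_def subset_closed_segment)
  qed
  have e_norm: "norm (e i) = 1" "e i \<noteq> 0" if "i < 3" for i
    using i3[OF that] by (auto simp: e_def norm_axis_1 axis_eq_0_iff)
  have ortho: "e i \<bullet> e j = 0" if "i < 3" "j < i" for i j
  proof -
    have "i = 1 \<and> j = 0 \<or> i = 2 \<and> j = 0 \<or> i = 2 \<and> j = 1" using that by auto
    then show ?thesis by (auto simp: e_def inner_axis_axis)
  qed
  have arm_meet: "arm t i \<inter> arm t j \<subseteq> {0}" if "i < 3" "j < i" for i j t
  proof
    fix x assume x: "x \<in> arm t i \<inter> arm t j"
    obtain a where a: "x = (a * t) *\<^sub>R e i" using x by (auto simp: arm_def in_segment)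
    obtain b where b: "x = (b * t) *\<^sub>R e j" using x by (auto simp: arm_def in_segment)
    from a b have "x \<bullet> x = (a * t) * (b * t) * (e i \<bullet> e j)" by (metis inner_scaleR_left inner_scaleR_right mult.assoc)
    then show "x \<in> {0}" using ortho[OF that] by simp
  qed
  have 0: "0 \<in> tripod" by (simp add: tripod_def)
  show thesis
  proof (rule that[of "h 0"])
    show "h 0 \<in> topspace X" using cont 0 by (metis continuous_map_image_subset_topspace image_subset_iff topspace_euclidean_subtopology)
    fix W assume W: "openin X W" "h 0 \<in> W"
    have "openin (top_of_set tripod) {x \<in> tripod. h x \<in> W}"
      using openin_continuous_map_preimage[OF cont W(1)] by simp
    moreover have "0 \<in> {x \<in> tripod. h x \<in> W}" using 0 W(2) by simp
    ultimately obtain r where r: "0 < r" "ball 0 r \<inter> tripod \<subseteq> {x \<in> tripod. h x \<in> W}"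
      unfolding openin_contains_ball by blast
    define t where "t = min 1 (r / 2)"
    have t: "0 < t" "t \<le> 1" "t < r" using r by (auto simp: t_def)
    have armT: "arm t i \<subseteq> tripod" if "i < 3" for i using arm1[OF that] arm_sub[OF t(1,2)] by blast
    show "\<exists>S :: nat \<Rightarrow> 'a set. (\<forall>i<3. compactin X (S i) \<and> connectedin X (S i) \<and> h 0 \<in> S i \<and> S i \<subseteq> W \<and> (\<exists>b\<in>S i. b \<noteq> h 0)) \<and>
       (\<forall>i<3. \<forall>j<i. S i \<inter> S j \<subseteq> {h 0})"
    proof (intro exI[of _ "\<lambda>i. h ` arm t i"] conjI allI impI)
      fix i :: nat assume i: "i < 3"
      have "compactin (top_of_set tripod) (arm t i)" using armT[OF i] by (simp add: compactin_subtopology arm_def)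
      then show "compactin X (h ` arm t i)" using cont by (rule image_compactin)
      have "connectedin (top_of_set tripod) (arm t i)" using armT[OF i] by (simp add: connectedin_subtopology arm_def)
      with cont show "connectedin X (h ` arm t i)" by (rule connectedin_continuous_map_image)
      show "h 0 \<in> h ` arm t i" by (simp add: arm_def)
      show "h ` arm t i \<subseteq> W"
      proof
        fix y assume "y \<in> h ` arm t i"
        then obtain x where x: "x \<in> arm t i" "y = h x" by blast
        then obtain u where u: "0 \<le> u" "u \<le> 1" "x = u *\<^sub>R t *\<^sub>R e i"
          unfolding arm_def in_segment by auto
        have "norm (u *\<^sub>R t *\<^sub>R e i) = u * t" using u t e_norm[OF i] by simp
        also have "\<dots> \<le> 1 * t" using u t by (intro mult_right_mono) auto
        finally have "norm (u *\<^sub>R t *\<^sub>R e i) < r" using t by simp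
        then have "x \<in> ball 0 r \<inter> tripod" using armT[OF i] x u(3) by auto
        then show "y \<in> W" using r(2) x(2) by blast
      qed
      have "t *\<^sub>R e i \<in> arm t i" by (simp add: arm_def)
      moreover from this have "h (t *\<^sub>R e i) \<noteq> h 0"
        using inj_onD[OF inj, of "t *\<^sub>R e i" 0] armT[OF i] 0 t e_norm[OF i] by auto
      ultimately show "\<exists>b\<in>h ` arm t i. b \<noteq> h 0" by blast
      fix j assume j: "j < i"
      show "h ` arm t i \<inter> h ` arm t j \<subseteq> {h 0}"
      proof
        fix y assume "y \<in> h ` arm t i \<inter> h ` arm t j"
        then obtain x x' where x: "x \<in> arm t i" "x' \<in> arm t j" "y = h x" "y = h x'" by blast
        then have "x = x'" using inj_onD[OF inj, of x x'] armT[of i] armT[of j] i j by auto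
        then have "x = 0" using arm_meet[OF i j, of t] x by auto
        then show "y \<in> {h 0}" using x by simp
      qed
    qed
  qed
qed

text \<open>A set of diameter less than l/3 cannot meet both the first and the last third of an
  interval of length \<open>l\<close>. Passing to a third it misses handles one set, and the
  remaining ones follow by induction. The sets will be the values of a function near branch
  points.\<close>

lemma interval_avoiding:
  fixes S :: "'b \<Rightarrow> real set" and a l :: real
  assumes "finite G" "0 < l" "\<And>x s s'. x \<in> G \<Longrightarrow> s \<in> S x \<Longrightarrow> s' \<in> S x \<Longrightarrow> \<bar>s - s'\<bar> < l / 3 ^ card G"
  shows "\<exists>v\<ge>a. v + l / 3 ^ card G \<le> a + l \<and> (\<forall>x\<in>G. S x \<inter> {v..v + l / 3 ^ card G} = {})"
  using assms
proof (induction G arbitrary: a l rule: finite_induct)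
  case empty then show ?case by (intro exI[of _ a]) auto
next
  case (insert y G)
  have eq: "l / 3 ^ card (insert y G) = l / 3 / 3 ^ card G" using insert.hyps by simp
  have IH: "\<exists>v\<ge>b. v + l / 3 / 3 ^ card G \<le> b + l / 3 \<and> (\<forall>x\<in>G. S x \<inter> {v..v + l / 3 / 3 ^ card G} = {})" for b
    using insert.prems unfolding eq by (intro insert.IH) auto
  have small: "l / 3 / 3 ^ card G \<le> l / 3" using insert.prems(1) by (simp add: divide_le_eq)
  obtain b where b: "a \<le> b" "b + l / 3 \<le> a + l" "S y \<inter> {b..b + l / 3} = {}"
  proof (cases "S y \<inter> {a..a + l / 3} = {}")
    case True then show thesis using that[of a] insert.prems(1) by auto
  next
    case False
    then obtain s where s: "s \<in> S y" "s \<le> a + l / 3" by auto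
    have "S y \<inter> {a + 2 * l / 3..a + 2 * l / 3 + l / 3} = {}"
    proof (rule ccontr)
      assume "S y \<inter> {a + 2 * l / 3..a + 2 * l / 3 + l / 3} \<noteq> {}"
      then obtain s' where s': "s' \<in> S y" "a + 2 * l / 3 \<le> s'" by auto
      have "\<bar>s' - s\<bar> < l / 3 / 3 ^ card G" using insert.prems(2)[of y s' s] s s' unfolding eq by simp
      then show False using small s s' by linarith
    qed
    then show thesis using insert.prems(1) by (intro that[of "a + 2 * l / 3"]) auto
  qed
  obtain v where v: "b \<le> v" "v + l / 3 / 3 ^ card G \<le> b + l / 3" "\<forall>x\<in>G. S x \<inter> {v..v + l / 3 / 3 ^ card G} = {}"
    using IH by blast
  have "S y \<inter> {v..v + l / 3 / 3 ^ card G} = {}" using b(3) v(1,2) by fastforce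
  then show ?case unfolding eq using v b by (intro exI[of _ v]) auto
qed

section \<open>Distortion of pullbacks\<close>

lemma finite_positive_lower_bound:
  fixes g :: "'b \<Rightarrow> real"
  assumes "finite A" "\<And>x. x \<in> A \<Longrightarrow> 0 < g x"
  obtains c where "0 < c" "\<And>x. x \<in> A \<Longrightarrow> c \<le> g x"
proof (cases "A = {}")
  case True then show thesis using that[of 1] by auto
next
  case False
  then show thesis using assms that[of "Min (g ` A)"] by auto
qed

lemma increasing_homeomorphism_preimage:
  assumes "increasing_homeomorphism \<delta>" "0 < c"
  obtains t where "0 < t" "\<delta> t = c" "\<And>x. 0 \<le> x \<Longrightarrow> c < \<delta> x \<Longrightarrow> t < x" "\<And>x. 0 \<le> x \<Longrightarrow> x < t \<Longrightarrow> \<delta> x < c"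
proof -
  have surj: "\<delta> ` {0..} = {0..}" and mono: "strict_mono_on {0..} \<delta>"
    using assms(1) homeomorphic_imp_surjective_map by (fastforce simp: increasing_homeomorphism_def)+
  obtain s where s: "0 \<le> s" "\<delta> s = 0" using surj by (metis atLeast_iff imageE order_refl)
  obtain t where t: "0 \<le> t" "\<delta> t = c" using surj assms(2) by (metis atLeast_iff imageE less_imp_le)
  have "s < t"
  proof (rule ccontr)
    assume "\<not> s < t"
    then have "t < s" using s t assms(2) by (cases "s = t") auto
    then show False using strict_mono_onD[OF mono, of t s] s t assms(2) by auto
  qed
  show thesis
  proof (rule that)
    show "0 < t" using s \<open>s < t\<close> by simp
    show "\<delta> t = c" by fact
    show "t < x" if "0 \<le> x" "c < \<delta> x" for x
    proof (rule ccontr)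
      assume "\<not> t < x"
      then show False using strict_mono_onD[OF mono, of x t] that t by (cases "x = t") auto
    qed
    show "\<delta> x < c" if "0 \<le> x" "x < t" for x
      using strict_mono_onD[OF mono, of x t] that t by auto
  qed
qed

section \<open>Roundness of open sets\<close>

context Metric_space
begin

text \<open>Let \<open>S\<close> be the outer radius and \<open>T\<close> the inradius about
  \<open>a\<close>; a point outside \<open>A\<close> makes \<open>T\<close> finite. If T > S, then
  \<open>A\<close> would be the closed ball of radius \<open>S\<close>, hence clopen and the whole
  space. The last bound follows from diam A \<le> 2S < 2RT.\<close>

lemma roundness_bounds:
  assumes "mbounded M" "connected_space mtopology" "openin mtopology A" "A \<noteq> M"
    and "0 < \<mu>" "mball a \<mu> \<subseteq> A" "a \<in> A"
  shows "1 \<le> roundness M d A a" "roundness M d A a \<le> diam d M / \<mu>"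
    and "roundness M d A a < R \<Longrightarrow> mball a (diam d A / (2 * R)) \<subseteq> A"
proof -
  have AM: "A \<subseteq> M" using openin_subset[OF assms(3)] by simp
  then have aM: "a \<in> M" using assms by auto
  obtain y where y: "y \<in> M" "y \<notin> A" using AM assms(4) by auto
  define S where "S = (SUP x\<in>A. d x a)"
  define T where "T = Sup {r. mball a r \<subseteq> A}"
  have round: "roundness M d A a = S / T" by (simp add: roundness_def S_def T_def)
  have bS: "bdd_above ((\<lambda>x. d x a) ` A)"
    using AM aM by (intro bdd_aboveI[of _ "diam d M"]) (auto intro: diam_upper[OF assms(1)])
  have S: "d x a \<le> S" if "x \<in> A" for x unfolding S_def using that bS by (rule cSUP_upper)
  have S_le: "S \<le> diam d M"
    unfolding S_def using assms(7) AM aM by (intro cSUP_least) (auto intro: diam_upper[OF assms(1)])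
  have S0: "0 \<le> S" using S[OF assms(7)] nonneg by (meson order_trans)
  have bT: "r \<le> d a y" if "mball a r \<subseteq> A" for r
    using that y aM by (metis in_mball not_le subsetD)
  then have bT': "bdd_above {r. mball a r \<subseteq> A}" by (intro bdd_aboveI[of _ "d a y"]) auto
  have T: "r \<le> T" if "mball a r \<subseteq> A" for r unfolding T_def using that bT' by (intro cSup_upper) auto
  have \<mu>T: "\<mu> \<le> T" using T assms by simp
  then have T0: "0 < T" using assms by simp
  have Tball: "mball a r \<subseteq> A" if rT: "r < T" for r
  proof -
    have "{r. mball a r \<subseteq> A} \<noteq> {}" using assms by auto
    then obtain r' where r': "mball a r' \<subseteq> A" "r < r'"
      using rT less_cSup_iff[OF _ bT'] unfolding T_def by auto
    then show ?thesis using mball_subset_concentric[of r r'] by auto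
  qed
  have "T \<le> S"
  proof (rule ccontr)
    assume "\<not> T \<le> S"
    then have ST: "S < (S + T) / 2" "(S + T) / 2 < T" by simp_all
    have "A \<subseteq> mcball a S" using S AM aM commute by auto
    moreover have "mcball a S \<subseteq> mball a ((S + T) / 2)" using ST by auto
    ultimately have "A = mcball a S" using Tball[OF ST(2)] by auto
    then have "closedin mtopology A" by simp
    then have "A = M" using assms(2,3,7) connected_space_clopen_in[of mtopology] by auto
    then show False using assms by simp
  qed
  then show "1 \<le> roundness M d A a" using T0 by (simp add: round)
  have "S / T \<le> S / \<mu>" using \<mu>T assms S0 by (intro divide_left_mono) auto
  also have "\<dots> \<le> diam d M / \<mu>" using S_le assms by (intro divide_right_mono) auto
  finally show "roundness M d A a \<le> diam d M / \<mu>" using round by simp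
  assume R: "roundness M d A a < R"
  have dA: "diam d A \<le> 2 * S"
  proof (rule diam_least)
    show "A \<noteq> {}" using assms by auto
    fix u v assume uv: "u \<in> A" "v \<in> A"
    have "d u v \<le> d u a + d v a" using uv AM aM by (auto intro: triangle')
    then show "d u v \<le> 2 * S" using S[OF uv(1)] S[OF uv(2)] by simp
  qed
  have "1 < R" using R \<open>1 \<le> roundness M d A a\<close> by simp
  have "S < R * T" using R round T0 by (simp add: pos_divide_less_eq)
  then have "diam d A / (2 * R) < T" using dA \<open>1 < R\<close> by (simp add: field_simps)
  then show "mball a (diam d A / (2 * R)) \<subseteq> A" by (rule Tball)
qed

end

section \<open>Metric estimates uniform over all levels\<close>

locale metric_cxc_system = topological_cxc_system X f \<U>0 + Metric_space "topspace X" d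
  for X :: "'a topology" and f \<U>0 d +
  fixes \<rho>m \<rho>p \<delta>m \<delta>p :: "real \<Rightarrow> real"
  assumes mtop: "mtopology = X"
    and \<rho>m: "increasing_embedding \<rho>m"
    and \<delta>m: "increasing_homeomorphism \<delta>m" and \<delta>p: "increasing_homeomorphism \<delta>p"
    and roundness_dist: "roundness_distortion X f \<U>0 d \<rho>m \<rho>p"
    and diameter_dist: "diameter_distortion X f \<U>0 d \<delta>m \<delta>p"
begin

lemma mbounded_all: "A \<subseteq> M \<Longrightarrow> mbounded A"
proof -
  have "compactin mtopology M" using X_space(1) by (simp add: mtop compact_space_def)
  then show "A \<subseteq> M \<Longrightarrow> mbounded A" using compactin_imp_mbounded mbounded_subset by blast
qed

lemma diam_cover_pos: assumes "U \<in> \<U> n" shows "0 < diam d U"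
proof -
  obtain x y where "x \<in> M" "y \<in> M" "x \<noteq> y" by (rule two_points)
  then obtain a b where ab: "a \<in> U" "b \<in> U" "a \<noteq> b"
    using connected_open_two_points[OF X_space(2,3) cover_element(1,3)[OF assms]] by metis
  have "U \<subseteq> M" using cover_element_subset[OF assms] .
  then have "0 < d a b" using ab mdist_pos_less[of a b] by blast
  also have "\<dots> \<le> diam d U" using ab \<open>U \<subseteq> M\<close> by (intro diam_upper mbounded_all)
  finally show ?thesis .
qed

lemma expansion_small:
  assumes "0 < \<epsilon>"
  shows "\<forall>\<^sub>F n in sequentially. \<forall>V\<in>\<U> n. diam d V < \<epsilon>"
proof -
  let ?V = "(\<lambda>x. mball x (\<epsilon> / 3)) ` M"
  have "(\<forall>V\<in>?V. openin X V) \<and> \<Union>?V = M"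
  proof (intro conjI ballI)
    fix V assume "V \<in> ?V" then show "openin X V" using openin_mball mtop by auto
  next
    show "\<Union>?V = M" using assms by auto
  qed
  then have "\<exists>N. \<forall>n>N. \<forall>U\<in>\<U> n. \<exists>V\<in>?V. U \<subseteq> V"
    using top_cxc unfolding topological_cxc_wrt_def cxc_expansion_def by blast
  then obtain N where N: "\<forall>n>N. \<forall>U\<in>\<U> n. \<exists>V\<in>?V. U \<subseteq> V" by blast
  have "diam d U < \<epsilon>" if n: "Suc N \<le> n" and U: "U \<in> \<U> n" for n U
  proof -
    obtain x where x: "x \<in> M" "U \<subseteq> mball x (\<epsilon> / 3)" using N n U by (force simp: Suc_le_eq)
    have "diam d U \<le> 2 * \<epsilon> / 3"
    proof (rule diam_least)
      show "U \<noteq> {}" using cover_element U by blast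
      fix a b assume ab: "a \<in> U" "b \<in> U"
      then have "a \<in> mball x (\<epsilon> / 3)" "b \<in> mball x (\<epsilon> / 3)" using x by auto
      moreover from this have "d a b \<le> d x a + d x b" using x by (intro triangle'') auto
      ultimately show "d a b \<le> 2 * \<epsilon> / 3" by simp
    qed
    then show ?thesis using assms by simp
  qed
  then show ?thesis unfolding eventually_sequentially by blast
qed

lemma lebesgue_cover:
  obtains \<mu> where "0 < \<mu>" "\<And>v. v \<in> M \<Longrightarrow> \<exists>V\<in>\<U> q. mball v \<mu> \<subseteq> V"
proof -
  have "compactin mtopology M" using X_space(1) by (simp add: mtop compact_space_def)
  moreover have "M \<subseteq> \<Union>(\<U> q)" using cover_covers by simp
  moreover have "openin mtopology U" if "U \<in> \<U> q" for U using cover_element(1)[OF that] by (simp add: mtop)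
  ultimately show thesis using lebesgue_number[of M "\<U> q"] that by blast
qed

text \<open>The images have the fixed levels 0 and \<open>q\<close>, each with finitely many
  elements. Bounds on ratios there are carried by the distortion functions to all \<open>n\<close>
  at once.\<close>

lemma diam_ratio_distortion:
  assumes "U' \<in> \<U> n" "V' \<in> \<U> (q + n)" "V' \<subseteq> U'"
  shows "diam d V' / diam d U' < \<delta>m (diam d ((f ^^ n) ` V') / diam d ((f ^^ n) ` U'))"
    and "diam d ((f ^^ n) ` V') / diam d ((f ^^ n) ` U') < \<delta>p (diam d V' / diam d U')"
proof -
  have "(f ^^ n) ` U' \<in> \<U> 0" "(f ^^ n) ` V' \<in> \<U> q" "U' \<in> \<U> (0 + n)" "(f ^^ n) ` V' \<subseteq> (f ^^ n) ` U'"
    using assms cover_image[of U' 0 n] cover_image[of V' q n] by auto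
  then show "diam d V' / diam d U' < \<delta>m (diam d ((f ^^ n) ` V') / diam d ((f ^^ n) ` U'))"
     "diam d ((f ^^ n) ` V') / diam d ((f ^^ n) ` U') < \<delta>p (diam d V' / diam d U')"
    using diameter_dist assms(2,3) unfolding diameter_distortion_def by blast+
qed

lemma diam_ratio_lower:
  obtains t where "0 < t" "\<And>n U' V'. U' \<in> \<U> n \<Longrightarrow> V' \<in> \<U> (q + n) \<Longrightarrow> V' \<subseteq> U' \<Longrightarrow> t * diam d U' < diam d V'"
proof -
  obtain c where c: "0 < c" "\<And>V. V \<in> \<U> q \<Longrightarrow> c \<le> diam d V"
    using finite_positive_lower_bound[OF finite_cover, of q "diam d"] diam_cover_pos by metis
  have DM: "0 < diam d M"
  proof -
    obtain x where "x \<in> M" using two_points by blast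
    then obtain U where "U \<in> \<U> 0" "x \<in> U" using cover_covers by blast
    then show ?thesis using diam_cover_pos[of U 0] diam_mono[OF mbounded_all[OF order_refl], of U]
        cover_element_subset[of U 0] by auto
  qed
  have c0: "0 < c / (2 * diam d M)" using c DM by simp
  obtain t where t: "0 < t" "\<And>x. 0 \<le> x \<Longrightarrow> c / (2 * diam d M) < \<delta>p x \<Longrightarrow> t < x"
    by (rule increasing_homeomorphism_preimage[OF \<delta>p c0]) blast
  have "t * diam d U' < diam d V'" if U': "U' \<in> \<U> n" "V' \<in> \<U> (q + n)" "V' \<subseteq> U'" for n U' V'
  proof -
    let ?U = "(f ^^ n) ` U'" and ?V = "(f ^^ n) ` V'"
    have UV: "?U \<in> \<U> 0" "?V \<in> \<U> q" using U' cover_image[of U' 0 n] cover_image[of V' q n] by auto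
    have "diam d ?U \<le> diam d M" using cover_element_subset[OF UV(1)] by (intro diam_mono mbounded_all) auto
    then have "c / (2 * diam d M) \<le> diam d ?V / diam d ?U"
      using c(2)[OF UV(2)] c(1) diam_cover_pos[OF UV(1)] DM by (intro frac_le) auto
    also have "\<dots> < \<delta>p (diam d V' / diam d U')" using diam_ratio_distortion(2)[OF U'] .
    finally have "t < diam d V' / diam d U'"
      using diam_cover_pos[OF U'(1)] diam_cover_pos[OF U'(2)] by (intro t(2)) auto
    then show ?thesis using diam_cover_pos[OF U'(1)] by (simp add: pos_less_divide_eq)
  qed
  then show thesis by (rule that[OF t(1)])
qed

text \<open>Expansion makes the small sets at level \<open>q\<close> negligible against those at
  level 0, and \<open>\<delta>m\<close> preserves this relative smallness under pullback.\<close>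

lemma diam_ratio_small:
  assumes "0 < \<kappa>"
  shows "\<forall>\<^sub>F q in sequentially. \<forall>n. \<forall>U'\<in>\<U> n. \<forall>V'\<in>\<U> (q + n). V' \<subseteq> U' \<longrightarrow> diam d V' < \<kappa> * diam d U'"
proof -
  obtain t where t: "0 < t" "\<And>x. 0 \<le> x \<Longrightarrow> x < t \<Longrightarrow> \<delta>m x < \<kappa>"
    using increasing_homeomorphism_preimage[OF \<delta>m assms] by metis
  obtain c where c: "0 < c" "\<And>V. V \<in> \<U> 0 \<Longrightarrow> c \<le> diam d V"
    using finite_positive_lower_bound[OF finite_cover, of 0 "diam d"] diam_cover_pos by metis
  have "\<forall>\<^sub>F q in sequentially. \<forall>V\<in>\<U> q. diam d V < t * c" using t c by (intro expansion_small) auto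
  then show ?thesis
  proof (eventually_elim, intro allI ballI impI)
    fix q n U' V' assume q: "\<forall>V\<in>\<U> q. diam d V < t * c" and U': "U' \<in> \<U> n" "V' \<in> \<U> (q + n)" "V' \<subseteq> U'"
    let ?U = "(f ^^ n) ` U'" and ?V = "(f ^^ n) ` V'"
    have UV: "?U \<in> \<U> 0" "?V \<in> \<U> q" using U' cover_image[of U' 0 n] cover_image[of V' q n] by auto
    have "diam d ?V < t * c" using q UV by auto
    also have "\<dots> \<le> t * diam d ?U" using c(2)[OF UV(1)] t by simp
    finally have "diam d ?V / diam d ?U < t" using diam_cover_pos[OF UV(1)] by (simp add: pos_divide_less_eq)
    then have "\<delta>m (diam d ?V / diam d ?U) < \<kappa>"
      using diam_cover_pos[OF UV(1)] diam_cover_pos[OF UV(2)] by (intro t(2)) auto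
    with diam_ratio_distortion(1)[OF U'] have "diam d V' / diam d U' < \<kappa>" by simp
    then show "diam d V' < \<kappa> * diam d U'" using diam_cover_pos[OF U'(1)] by (simp add: pos_divide_less_eq)
  qed
qed

text \<open>Downstairs a Lebesgue ball inside \<open>V\<close> bounds the roundness, and
  \<open>\<rho>m\<close> turns this into a bound for the lift \<open>V'\<close>. As the diameter of
  \<open>V'\<close> is a definite part of that of \<open>U'\<close>, bounded roundness yields a ball
  of definite relative size. The condition on the elements around the image of \<open>x\<close>
  keeps the lift inside \<open>U'\<close>.\<close>

lemma round_subelement:
  obtains c where "0 < c"
    "\<And>n U' x. U' \<in> \<U> n \<Longrightarrow> x \<in> U' \<Longrightarrow> (\<And>V. V \<in> \<U> q \<Longrightarrow> (f ^^ n) x \<in> V \<Longrightarrow> V \<subseteq> (f ^^ n) ` U') \<Longrightarrow>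
      \<exists>V'\<in>\<U> (q + n). x \<in> V' \<and> V' \<subseteq> U' \<and> mball x (c * diam d U') \<subseteq> V'"
proof -
  obtain \<mu> where \<mu>: "0 < \<mu>" "\<And>v. v \<in> M \<Longrightarrow> \<exists>V\<in>\<U> q. mball v \<mu> \<subseteq> V" by (rule lebesgue_cover[of q]) blast
  obtain t where t: "0 < t"
    "\<And>n U' V'. U' \<in> \<U> n \<Longrightarrow> V' \<in> \<U> (q + n) \<Longrightarrow> V' \<subseteq> U' \<Longrightarrow> t * diam d U' < diam d V'"
    by (rule diam_ratio_lower[of q]) blast
  \<comment> \<open>\<open>max 1\<close> puts \<open>R\<close> into [1, \<infinity>), where
    \<open>\<rho>m\<close> is monotone.\<close>
  define R where "R = max 1 (diam d M / \<mu>)"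
  have mono: "strict_mono_on {1..} \<rho>m" using \<rho>m by (simp add: increasing_embedding_def)
  have round: "1 \<le> roundness M d V v" "roundness M d V v \<le> diam d M / r" 
      "roundness M d V v < R' \<Longrightarrow> mball v (diam d V / (2 * R')) \<subseteq> V"
    if "V \<in> \<U> k" "v \<in> V" "0 < r" "mball v r \<subseteq> V" for V k v r R'
    using roundness_bounds[of V r v] mbounded_all[of M] X_space(3) cover_element(1)[OF that(1)] that
      space_notin_cover[of k] by (auto simp: mtop)
  define R' where "R' = max 1 (\<rho>m R)"
  have R': "1 \<le> R'" by (simp add: R'_def)
  show thesis
  proof (rule that[of "t / (2 * R')"])
    show "0 < t / (2 * R')" using t R' by simp
    fix n U' x
    assume U': "U' \<in> \<U> n" "x \<in> U'" and sub: "\<And>V. V \<in> \<U> q \<Longrightarrow> (f ^^ n) x \<in> V \<Longrightarrow> V \<subseteq> (f ^^ n) ` U'"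
    have xM: "x \<in> M" using U' cover_element_subset by blast
    then have fxM: "(f ^^ n) x \<in> M" by (rule iter_in)
    obtain V where V: "V \<in> \<U> q" "mball ((f ^^ n) x) \<mu> \<subseteq> V" using \<mu>(2)[OF fxM] by blast
    then have fxV: "(f ^^ n) x \<in> V" using \<mu>(1) fxM by (auto dest: subsetD[where c = "(f ^^ n) x"])
    obtain V' where V': "V' \<in> \<U> (q + n)" "x \<in> V'" "(f ^^ n) ` V' = V" by (rule cover_lift[OF V(1) xM fxV])
    have V'U': "V' \<subseteq> U'"
      using cover_maximal[of U' 0 n V'] U' V' sub[OF V(1) fxV] cover_element(2)[OF V'(1)] by auto
    have "openin mtopology V'" using cover_element(1)[OF V'(1)] by (simp add: mtop)
    then obtain r where r: "0 < r" "mball x r \<subseteq> V'" using V'(2) by (auto simp: openin_mtopology)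
    have rV: "roundness M d V ((f ^^ n) x) \<le> R"
      using round(2)[OF V(1) fxV \<mu>(1) V(2)] by (simp add: R_def)
    have "roundness M d V' x < \<rho>m (roundness M d V ((f ^^ n) x))"
      using roundness_dist V V' fxV unfolding roundness_distortion_def by blast
    also have "\<dots> \<le> \<rho>m R"
      using strict_mono_on_leD[OF mono _ _ rV] round(1)[OF V(1) fxV \<mu>(1) V(2)] by (simp add: R_def)
    also have "\<dots> \<le> R'" by (simp add: R'_def)
    finally have "mball x (diam d V' / (2 * R')) \<subseteq> V'" by (rule round(3)[OF V'(1,2) r])
    moreover have "t / (2 * R') * diam d U' \<le> diam d V' / (2 * R')"
      using t(2)[OF U'(1) V'(1) V'U'] R' by (simp add: field_simps)
    then have "mball x (t / (2 * R') * diam d U') \<subseteq> mball x (diam d V' / (2 * R'))"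
      by (rule mball_subset_concentric)
    ultimately show "\<exists>V'\<in>\<U> (q + n). x \<in> V' \<and> V' \<subseteq> U' \<and> mball x (t / (2 * R') * diam d U') \<subseteq> V'"
      using V' V'U' by blast
  qed
qed

text \<open>Converts topological separation downstairs into a distance proportional to
  \<open>diam d U'\<close>: the ball about \<open>x\<close> lies in an element \<open>V'\<close>
  whose image is one of the elements \<open>V\<close> that avoid the image of
  \<open>y\<close>.\<close>

lemma separation_pullback:
  obtains c where "0 < c"
    "\<And>n U' x y. U' \<in> \<U> n \<Longrightarrow> x \<in> U' \<Longrightarrow> y \<in> M \<Longrightarrow>
      (\<And>V. V \<in> \<U> q \<Longrightarrow> (f ^^ n) x \<in> V \<Longrightarrow> V \<subseteq> (f ^^ n) ` U' \<and> (f ^^ n) y \<notin> V) \<Longrightarrow> c * diam d U' \<le> d x y"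
proof -
  obtain c where c: "0 < c"
    "\<And>n U' x. U' \<in> \<U> n \<Longrightarrow> x \<in> U' \<Longrightarrow> (\<And>V. V \<in> \<U> q \<Longrightarrow> (f ^^ n) x \<in> V \<Longrightarrow> V \<subseteq> (f ^^ n) ` U') \<Longrightarrow>
      \<exists>V'\<in>\<U> (q + n). x \<in> V' \<and> V' \<subseteq> U' \<and> mball x (c * diam d U') \<subseteq> V'"
    by (rule round_subelement[of q]) blast
  show thesis
  proof (rule that[OF c(1)])
    fix n U' x y assume U': "U' \<in> \<U> n" "x \<in> U'" "y \<in> M"
      and sub: "\<And>V. V \<in> \<U> q \<Longrightarrow> (f ^^ n) x \<in> V \<Longrightarrow> V \<subseteq> (f ^^ n) ` U' \<and> (f ^^ n) y \<notin> V"
    then obtain V' where V': "V' \<in> \<U> (q + n)" "x \<in> V'" "mball x (c * diam d U') \<subseteq> V'"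
      using c(2)[OF U'(1,2)] by blast
    have "y \<notin> V'" using sub[OF cover_image[OF V'(1)]] V'(2) by blast
    then have "y \<notin> mball x (c * diam d U')" using V' by blast
    then show "c * diam d U' \<le> d x y" using U' cover_element_subset[OF U'(1)] by auto
  qed
qed

text \<open>The elements \<open>g n\<close> around \<open>z\<close> have images containing a
  Lebesgue ball, and elements of level \<open>q\<close> are shorter than its radius, so
  \<open>g (q + n)\<close> falls into \<open>g n\<close>. Along multiples of \<open>q\<close> the
  diameter never drops by more than the factor \<open>t\<close>, hence the first one below
  \<open>r\<close> is still at least \<open>t * r\<close>. The choice of \<open>r0\<close> excludes
  level 0.\<close>

lemma element_at_scale:
  obtains c r0 where "0 < c" "0 < r0"
    "\<And>z r. z \<in> M \<Longrightarrow> 0 < r \<Longrightarrow> r \<le> r0 \<Longrightarrow> \<exists>n. \<exists>U\<in>\<U> n. z \<in> U \<and> diam d U < r \<and> c * r \<le> diam d U"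
proof -
  obtain \<mu> where \<mu>: "0 < \<mu>" "\<And>v. v \<in> M \<Longrightarrow> \<exists>V\<in>\<U> 0. mball v \<mu> \<subseteq> V" by (rule lebesgue_cover[of 0]) blast
  have "\<forall>\<^sub>F q in sequentially. (\<forall>V\<in>\<U> q. diam d V < \<mu>) \<and> 0 < q"
    using expansion_small[OF \<mu>(1)] eventually_gt_at_top[of 0] by eventually_elim auto
  then obtain q where q: "\<And>V. V \<in> \<U> q \<Longrightarrow> diam d V < \<mu>" "0 < q"
    using eventually_happens'[OF sequentially_bot] by blast
  obtain t where t: "0 < t"
    "\<And>n U' V'. U' \<in> \<U> n \<Longrightarrow> V' \<in> \<U> (q + n) \<Longrightarrow> V' \<subseteq> U' \<Longrightarrow> t * diam d U' < diam d V'"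
    by (rule diam_ratio_lower[of q]) blast
  obtain r0 where r0: "0 < r0" "\<And>V. V \<in> \<U> 0 \<Longrightarrow> r0 \<le> diam d V"
    using finite_positive_lower_bound[OF finite_cover, of 0 "diam d"] diam_cover_pos by metis
  show thesis
  proof (rule that[OF t(1) r0(1)])
    fix z r assume z: "z \<in> M" and r: "0 < r" "r \<le> r0"
    have "\<exists>U'. U' \<in> \<U> n \<and> z \<in> U' \<and> mball ((f ^^ n) z) \<mu> \<subseteq> (f ^^ n) ` U'" for n
    proof -
      obtain V where V: "V \<in> \<U> 0" "mball ((f ^^ n) z) \<mu> \<subseteq> V" using \<mu>(2)[OF iter_in[OF z]] by blast
      moreover have "(f ^^ n) z \<in> V" using V(2) \<mu>(1) iter_in[OF z] by (auto dest: subsetD[where c = "(f ^^ n) z"])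
      ultimately show ?thesis using cover_lift[of V 0 z n] z by (metis add_0)
    qed
    then obtain g where g: "\<And>n. g n \<in> \<U> n" "\<And>n. z \<in> g n" "\<And>n. mball ((f ^^ n) z) \<mu> \<subseteq> (f ^^ n) ` g n" by metis
    have nest: "g (q + n) \<subseteq> g n" for n
    proof (rule cover_maximal[of _ 0 n])
      show "g n \<in> \<U> (0 + n)" using g by simp
      show "connectedin X (g (q + n))" using cover_element g by blast
      show "g (q + n) \<inter> g n \<noteq> {}" using g by blast
      have V: "(f ^^ n) ` g (q + n) \<in> \<U> q" using cover_image g by blast
      have "(f ^^ n) ` g (q + n) \<subseteq> mball ((f ^^ n) z) \<mu>"
      proof
        fix y assume y: "y \<in> (f ^^ n) ` g (q + n)"
        have "d ((f ^^ n) z) y \<le> diam d ((f ^^ n) ` g (q + n))"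
          using y g(2) cover_element_subset[OF V] by (intro diam_upper mbounded_all) auto
        then show "y \<in> mball ((f ^^ n) z) \<mu>"
          using q(1)[OF V] y cover_element_subset[OF V] iter_in[OF z] by auto
      qed
      then show "(f ^^ n) ` g (q + n) \<subseteq> (f ^^ n) ` g n" using g(3) by blast
    qed
    have "\<forall>\<^sub>F n in sequentially. \<forall>V\<in>\<U> n. diam d V < r" using r by (intro expansion_small)
    then obtain N where N: "\<And>n V. N \<le> n \<Longrightarrow> V \<in> \<U> n \<Longrightarrow> diam d V < r" unfolding eventually_sequentially by blast
    have "N \<le> N * q" using q(2) by simp
    then have ex: "\<exists>j. diam d (g (j * q)) < r" using N g(1) by blast
    define j where "j = (LEAST j. diam d (g (j * q)) < r)"
    have j: "diam d (g (j * q)) < r" unfolding j_def using ex by (rule LeastI_ex)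
    have "j \<noteq> 0"
    proof
      assume "j = 0"
      then have "diam d (g 0) < r" using j by (simp only: mult_0)
      then show False using r r0(2)[OF g(1)[of 0]] by linarith
    qed
    then obtain i where i: "j = Suc i" using not0_implies_Suc by blast
    have "\<not> diam d (g (i * q)) < r"
      using not_less_Least[of i "\<lambda>j. diam d (g (j * q)) < r"] i unfolding j_def by simp
    then have "t * r \<le> t * diam d (g (i * q))" using t by simp
    also have "\<dots> < diam d (g (q + i * q))" using t(2)[OF g(1) g(1) nest] .
    finally have "t * r \<le> diam d (g (j * q))" by (simp add: i)
    then show "\<exists>n. \<exists>U\<in>\<U> n. z \<in> U \<and> diam d U < r \<and> t * r \<le> diam d U" using j g by blast
  qed
qed

end

section \<open>Tripods at all places and scales\<close>

context topological_cxc_system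
begin

text \<open>A weak form of being the branch point of a tripod. Arms inside every neighbourhood are
  demanded, because they must fit into the image of an arbitrarily small cover element.\<close>

definition tripod_centre :: "'a \<Rightarrow> bool" where
  "tripod_centre p \<longleftrightarrow> p \<in> M \<and> (\<forall>W. openin X W \<and> p \<in> W \<longrightarrow> (\<exists>S :: nat \<Rightarrow> 'a set.
       (\<forall>i<3. compactin X (S i) \<and> connectedin X (S i) \<and> p \<in> S i \<and> S i \<subseteq> W \<and> (\<exists>b\<in>S i. b \<noteq> p)) \<and>
       (\<forall>i<3. \<forall>j<i. S i \<inter> S j \<subseteq> {p})))"

lemma closedin_finite: "finite F \<Longrightarrow> F \<subseteq> M \<Longrightarrow> closedin X F"
  using X_space(2) compactin_imp_closedin finite_imp_compactin by blast

text \<open>The lifts of two arms may meet again over the centre. Such points form the finite set \<open>F\<close>.\<close>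

lemma branched_tripod_in_open:
  assumes "tripod_centre p" "openin X U" "U \<noteq> {}"
  obtains u F and B :: "nat \<Rightarrow> 'a set" where "u \<in> U" "finite F" "F \<subseteq> U"
    "\<And>i. i < 3 \<Longrightarrow> compactin X (B i) \<and> connectedin X (B i) \<and> u \<in> B i \<and> B i \<subseteq> U \<and> (\<exists>b\<in>B i. b \<noteq> u)"
    "\<And>i j. i < 3 \<Longrightarrow> j < i \<Longrightarrow> B i \<inter> B j \<subseteq> F"
proof -
  have UM: "U \<subseteq> M" using assms(2) openin_subset by blast
  obtain m where m: "(f ^^ m) ` U = M"
    using top_cxc assms(2,3) unfolding topological_cxc_wrt_def cxc_irreducibility_def by blast
  then obtain u where u: "u \<in> U" "(f ^^ m) u = p" using assms(1) unfolding tripod_centre_def by (metis imageE)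
  \<comment> \<open>The lifts are confined to \<open>U\<close> by an element \<open>W\<close> of a
    late cover: a connected set that meets \<open>W\<close> and maps into its image stays in
    \<open>W\<close>. The level is at least \<open>m\<close>, so that the image is again an element
    and open.\<close>
  have "\<forall>\<^sub>F q in sequentially. \<forall>V\<in>\<U> q. V \<inter> {u} = {} \<or> V \<inter> (M - U) = {}"
    using u UM assms(2) closedin_finite[of "{u}"] by (intro expansion_separates) auto
  then have "\<forall>\<^sub>F q in sequentially. (\<forall>V\<in>\<U> q. V \<inter> {u} = {} \<or> V \<inter> (M - U) = {}) \<and> m \<le> q"
    using eventually_ge_at_top[of m] by eventually_elim auto
  then obtain q' where q': "\<forall>V\<in>\<U> q'. V \<inter> {u} = {} \<or> V \<inter> (M - U) = {}" "m \<le> q'"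
    using eventually_happens'[OF sequentially_bot] by blast
  define q where "q = q' - m"
  have q: "q' = q + m" using q'(2) by (simp add: q_def)
  obtain W where W: "W \<in> \<U> (q + m)" "u \<in> W" using cover_covers[of "q + m"] u UM by blast
  have "W \<inter> (M - U) = {}" using bspec[OF q'(1)] W q by blast
  then have WU: "W \<subseteq> U" using cover_element_subset[OF W(1)] by blast
  have fW: "(f ^^ m) ` W \<in> \<U> q" using cover_image[OF W(1)] .
  have "p \<in> (f ^^ m) ` W" using W(2) u by blast
  then have "\<exists>S :: nat \<Rightarrow> 'a set.
       (\<forall>i<3. compactin X (S i) \<and> connectedin X (S i) \<and> p \<in> S i \<and> S i \<subseteq> (f ^^ m) ` W \<and> (\<exists>b\<in>S i. b \<noteq> p)) \<and>
       (\<forall>i<3. \<forall>j<i. S i \<inter> S j \<subseteq> {p})"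
    by (intro assms(1)[unfolded tripod_centre_def, THEN conjunct2, rule_format] conjI cover_element(1)[OF fW])
  then obtain S :: "nat \<Rightarrow> 'a set" where S_conj:
    "(\<forall>i<3. compactin X (S i) \<and> connectedin X (S i) \<and> p \<in> S i \<and> S i \<subseteq> (f ^^ m) ` W \<and> (\<exists>b\<in>S i. b \<noteq> p)) \<and>
     (\<forall>i<3. \<forall>j<i. S i \<inter> S j \<subseteq> {p})" by (rule exE)
  note S = S_conj[THEN conjunct1, rule_format] and S' = S_conj[THEN conjunct2, rule_format]
  have "\<exists>B. compactin X B \<and> connectedin X B \<and> u \<in> B \<and> (f ^^ m) ` B = S i" if i: "i < 3" for i
  proof -
    have "compactin X (S i)" "connectedin X (S i)" "u \<in> M" "(f ^^ m) u \<in> S i" using S[OF i] u UM by auto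
    then show ?thesis
      by (rule open_map_continuum_component_onto[OF X_space(1,2,2) iter_continuous iter_open]) blast
  qed
  then obtain B where B: "\<And>i. i < 3 \<Longrightarrow> compactin X (B i) \<and> connectedin X (B i) \<and> u \<in> B i \<and> (f ^^ m) ` B i = S i"
    by metis
  have BW: "B i \<subseteq> W" if i: "i < 3" for i
    using B[OF i] S[OF i] W by (intro cover_maximal[OF W(1)]) auto
  define F where "F = {x \<in> U. (f ^^ m) x = p}"
  show thesis
  proof (rule that[OF u(1)])
    have "F \<subseteq> {x \<in> M. (f ^^ m) x = p}" using UM by (auto simp: F_def)
    then show "finite F" using iter_finite_fibre finite_subset by blast
    show "F \<subseteq> U" by (auto simp: F_def)
    show "compactin X (B i) \<and> connectedin X (B i) \<and> u \<in> B i \<and> B i \<subseteq> U \<and> (\<exists>b\<in>B i. b \<noteq> u)" if i: "i < 3" for i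
    proof -
      obtain b where "b \<in> S i" "b \<noteq> p" using S[OF i] by blast
      then have "\<exists>b\<in>B i. b \<noteq> u" using B[OF i] u by (metis imageE)
      then show ?thesis using B[OF i] BW[OF i] WU by blast
    qed
    show "B i \<inter> B j \<subseteq> F" if ij: "i < 3" "j < i" for i j
    proof
      fix x assume x: "x \<in> B i \<inter> B j"
      have j: "j < 3" using ij by simp
      have "(f ^^ m) x \<in> S i \<inter> S j" using x B[OF ij(1)] B[OF j] by blast
      then show "x \<in> F" using S'[OF ij] x BW[OF ij(1)] WU by (auto simp: F_def)
    qed
  qed
qed

end

section \<open>Antennas in pulled back tripods\<close>

context metric_cxc_system
begin

text \<open>All choices are made once in \<open>U\<close>, at the levels \<open>q1\<close>,
  \<open>q3\<close>, \<open>q2\<close>, and are carried to \<open>U'\<close> by estimates uniform in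
  \<open>n\<close>. Lifted arms can meet only over \<open>F\<close>. The parts over a neighbourhood
  \<open>N\<close> of \<open>F\<close> are bypassed by an interval of levels that avoids their
  values; the rest of the arms lies over disjoint closed sets and is separated.\<close>

lemma antenna_in_element:
  assumes "tripod_centre p" and U: "U \<in> \<U> 0"
  shows "\<exists>c>0. \<forall>n U' \<phi>. U' \<in> \<U> n \<and> (f ^^ n) ` U' = U \<and> one_lipschitz \<phi> \<longrightarrow> antenna_in U' (c * diam d U') \<phi>"
proof -
  have UM: "U \<subseteq> M" and oU: "openin X U" using cover_element_subset[OF U] cover_element(1)[OF U] .
  obtain u F and B :: "nat \<Rightarrow> 'a set" where u: "u \<in> U" and F: "finite F" "F \<subseteq> U"
    and B: "\<And>i. i < 3 \<Longrightarrow> compactin X (B i) \<and> connectedin X (B i) \<and> u \<in> B i \<and> B i \<subseteq> U \<and> (\<exists>b\<in>B i. b \<noteq> u)"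
    and BF: "\<And>i j. i < 3 \<Longrightarrow> j < i \<Longrightarrow> B i \<inter> B j \<subseteq> F"
    by (rule branched_tripod_in_open[OF assms(1) oU cover_element(3)[OF U]]) blast
  obtain b where b: "\<And>i. i < 3 \<Longrightarrow> b i \<in> B i \<and> b i \<noteq> u" using B by metis
  obtain p :: nat where p: "\<And>k U z. U \<in> \<U> k \<Longrightarrow> card {x \<in> U. (f ^^ k) x = z} \<le> p" by (rule degree_bound) blast
  \<comment> \<open>Bounds the number of points over \<open>F\<close> in any pullback of
    \<open>U\<close>.\<close>
  define P where "P = p * card F"
  have co: "closedin X (M - U)" using oU by auto
  have closedB: "closedin X (B i)" if "i < 3" for i
    using B[OF that] X_space(2) compactin_imp_closedin by blast
  have ev: "\<forall>\<^sub>F q in sequentially. \<forall>V\<in>\<U> q. V \<inter> K = {} \<or> V \<inter> (M - U) = {}" if "closedin X K" "K \<subseteq> U" for K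
    using that co by (intro expansion_separates) auto

  \<comment> \<open>Separates the point \<open>b i\<close> of each arm from the centre, so that a
    lifted arm reaches distance \<open>c1 * diam d U'\<close> from its own centre.\<close>
  have evb: "\<forall>\<^sub>F q in sequentially. \<forall>i\<in>{..<3::nat}. \<forall>V\<in>\<U> q. V \<inter> {u} = {} \<or> V \<inter> {b i} = {}"
  proof (intro eventually_ball_finite ballI)
    fix i :: nat assume "i \<in> {..<3}"
    then have "b i \<in> M" "b i \<noteq> u" using b[of i] B[of i] UM by auto
    then show "\<forall>\<^sub>F q in sequentially. \<forall>V\<in>\<U> q. V \<inter> {u} = {} \<or> V \<inter> {b i} = {}"
      using u UM by (intro expansion_separates closedin_finite) auto
  qed simp
  have "closedin X {u}" using u UM by (intro closedin_finite) auto
  have "{u} \<subseteq> U" using u by simp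
  from eventually_happens'[OF sequentially_bot eventually_conj[OF ev[OF \<open>closedin X {u}\<close> this] evb]]
  obtain q1 where q1: "\<forall>V\<in>\<U> q1. V \<inter> {u} = {} \<or> V \<inter> (M - U) = {}"
     "\<forall>i\<in>{..<3::nat}. \<forall>V\<in>\<U> q1. V \<inter> {u} = {} \<or> V \<inter> {b i} = {}" by (elim exE conjE) (rule that)
  obtain c1 where c1: "0 < c1"
    "\<And>n U' x y. U' \<in> \<U> n \<Longrightarrow> x \<in> U' \<Longrightarrow> y \<in> M \<Longrightarrow>
      (\<And>V. V \<in> \<U> q1 \<Longrightarrow> (f ^^ n) x \<in> V \<Longrightarrow> V \<subseteq> (f ^^ n) ` U' \<and> (f ^^ n) y \<notin> V) \<Longrightarrow> c1 * diam d U' \<le> d x y"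
    by (rule separation_pullback[of q1]) blast

  \<comment> \<open>An interval of length c1 D / 8, with D the diameter of \<open>U'\<close>, is cut
    to a third up to \<open>P\<close> times, so the lifts of the sets \<open>V a\<close> below have
    to be shorter than its 3^P-th part.\<close>
  define \<kappa> where "\<kappa> = c1 / (8 * 3 ^ P)"
  have \<kappa>: "0 < \<kappa>" using c1 by (simp add: \<kappa>_def)
  have "closedin X F" using F UM by (intro closedin_finite) auto
  from eventually_happens'[OF sequentially_bot eventually_conj[OF ev[OF this F(2)] diam_ratio_small[OF \<kappa>]]]
  obtain q3 where q3: "\<forall>V\<in>\<U> q3. V \<inter> F = {} \<or> V \<inter> (M - U) = {}"
     "\<forall>n. \<forall>U'\<in>\<U> n. \<forall>V'\<in>\<U> (q3 + n). V' \<subseteq> U' \<longrightarrow> diam d V' < \<kappa> * diam d U'" by (elim exE conjE) (rule that)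
  have "\<exists>V. V \<in> \<U> q3 \<and> a \<in> V" if "a \<in> F" for a using cover_covers[of q3] F(2) UM that by blast
  then obtain V where V: "\<And>a. a \<in> F \<Longrightarrow> V a \<in> \<U> q3 \<and> a \<in> V a" by metis
  have VU: "V a \<subseteq> U" if a: "a \<in> F" for a
    using bspec[OF q3(1), of "V a"] V[OF a] a cover_element_subset[of "V a" q3] by blast
  define N where "N = (\<Union>a\<in>F. V a)"
  have N: "openin X N" unfolding N_def using V cover_element(1) by blast
  \<comment> \<open>The arms become disjoint only after \<open>N\<close> is removed, so the
    separating level \<open>q2\<close> has to be chosen last.\<close>
  define K where "K i = B i - N" for i
  have closedK: "closedin X (K i)" if "i < 3" for i
    unfolding K_def using closedB[OF that] N by (rule closedin_diff)
  have FN: "F \<subseteq> N" using V by (auto simp: N_def)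

  have evK: "\<forall>\<^sub>F q in sequentially. \<forall>i\<in>{..<3::nat}. \<forall>j\<in>{..<i}. \<forall>V\<in>\<U> q. V \<inter> K i = {} \<or> V \<inter> K j = {}"
  proof (intro eventually_ball_finite ballI)
    fix i j :: nat assume "i \<in> {..<3}" "j \<in> {..<i}"
    then show "\<forall>\<^sub>F q in sequentially. \<forall>V\<in>\<U> q. V \<inter> K i = {} \<or> V \<inter> K j = {}"
      using closedK[of i] closedK[of j] BF[of i j] FN by (intro expansion_separates) (auto simp: K_def)
  qed auto
  have evB: "\<forall>\<^sub>F q in sequentially. \<forall>i\<in>{..<3::nat}. \<forall>V\<in>\<U> q. V \<inter> B i = {} \<or> V \<inter> (M - U) = {}"
    using closedB B by (intro eventually_ball_finite ballI ev) auto
  from eventually_happens'[OF sequentially_bot eventually_conj[OF evK evB]]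
  obtain q2 where q2: "\<forall>i\<in>{..<3::nat}. \<forall>j\<in>{..<i}. \<forall>V\<in>\<U> q2. V \<inter> K i = {} \<or> V \<inter> K j = {}"
    "\<forall>i\<in>{..<3::nat}. \<forall>V\<in>\<U> q2. V \<inter> B i = {} \<or> V \<inter> (M - U) = {}" by (elim exE conjE) (rule that)
  obtain c2 where c2: "0 < c2"
    "\<And>n U' x y. U' \<in> \<U> n \<Longrightarrow> x \<in> U' \<Longrightarrow> y \<in> M \<Longrightarrow>
      (\<And>V. V \<in> \<U> q2 \<Longrightarrow> (f ^^ n) x \<in> V \<Longrightarrow> V \<subseteq> (f ^^ n) ` U' \<and> (f ^^ n) y \<notin> V) \<Longrightarrow> c2 * diam d U' \<le> d x y"
    by (rule separation_pullback[of q2]) blast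

  define c where "c = min c1 (min \<kappa> c2)"
  have c0: "0 < c" using c1 c2 \<kappa> by (simp add: c_def)
  show ?thesis
  proof (intro exI[of _ c] conjI allI impI c0)
    fix n U' \<phi> assume "U' \<in> \<U> n \<and> (f ^^ n) ` U' = U \<and> one_lipschitz \<phi>"
    then have U': "U' \<in> \<U> n" "(f ^^ n) ` U' = U" and \<phi>: "one_lipschitz \<phi>" by auto
    define D where "D = diam d U'"
    have D: "0 < D" using diam_cover_pos[OF U'(1)] by (simp add: D_def)
    have U'M: "U' \<subseteq> M" using cover_element_subset[OF U'(1)] .
    obtain w where w: "w \<in> U'" "(f ^^ n) w = u" using u U'(2) by blast
    then have wM: "w \<in> M" using U'M by auto
    have "\<exists>A. compactin X A \<and> connectedin X A \<and> w \<in> A \<and> (f ^^ n) ` A = B i" if i: "i < 3" for i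
    proof -
      have "compactin X (B i)" "connectedin X (B i)" "(f ^^ n) w \<in> B i" using B[OF i] w by auto
      then show ?thesis
        by (rule open_map_continuum_component_onto[OF X_space(1,2,2) iter_continuous iter_open _ _ wM]) blast
    qed
    then obtain A where A: "\<And>i. i < 3 \<Longrightarrow> compactin X (A i) \<and> connectedin X (A i) \<and> w \<in> A i \<and> (f ^^ n) ` A i = B i"
      by metis
    have AU: "A i \<subseteq> U'" if i: "i < 3" for i
      using cover_maximal[of U' 0 n "A i"] A[OF i] B[OF i] w U' by auto
    have conA: "connectedin mtopology (A i)" if "i < 3" for i using A[OF that] by (simp add: mtop)
    \<comment> \<open>Stated for a general \<open>\<psi>\<close>, because arms on which
      \<open>\<phi>\<close> decreases are treated with its negative.\<close>
    have doubling: "\<exists>A B u L. A \<subseteq> U' \<and> B \<subseteq> U' \<and> c * D \<le> L \<and>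
        {u..u + L} \<subseteq> \<psi> ` A \<and> {u..u + L} \<subseteq> \<psi> ` B \<and> (\<forall>x\<in>A. \<forall>y\<in>B. L \<le> d x y)"
      if \<psi>: "one_lipschitz \<psi>" and ij: "i < 3" "j < i"
        and x: "x \<in> A i" "\<psi> w + c1 * D / 8 < \<psi> x" and y: "y \<in> A j" "\<psi> w + c1 * D / 8 < \<psi> y"
      for \<psi> i j x y
    proof -
      have j: "j < 3" using ij by simp
      define G where "G = {x \<in> U'. (f ^^ n) x \<in> F}"
      have G: "G = (\<Union>a\<in>F. {x \<in> U'. (f ^^ n) x = a})" by (auto simp: G_def)
      have "card G \<le> (\<Sum>a\<in>F. card {x \<in> U'. (f ^^ n) x = a})" unfolding G using F(1) by (rule card_UN_le)
      also have "\<dots> \<le> (\<Sum>a\<in>F. p)" using p[OF U'(1)] by (rule sum_mono)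
      finally have cardG: "card G \<le> P" by (simp add: P_def mult.commute)
      have finG: "finite G" unfolding G
      proof (rule finite_UN_I[OF F(1)])
        fix a show "finite {x \<in> U'. (f ^^ n) x = a}"
          using U'M by (intro finite_subset[OF _ iter_finite_fibre[of n a]]) auto
      qed
      have "\<exists>W. W \<in> \<U> (q3 + n) \<and> x \<in> W \<and> (f ^^ n) ` W = V ((f ^^ n) x)" if x: "x \<in> G" for x
      proof -
        have "(f ^^ n) x \<in> F" "x \<in> M" using x U'M by (auto simp: G_def)
        then have "V ((f ^^ n) x) \<in> \<U> q3" "x \<in> M" "(f ^^ n) x \<in> V ((f ^^ n) x)" using V by auto
        then show ?thesis by (rule cover_lift) blast
      qed
      then obtain W where W: "\<And>x. x \<in> G \<Longrightarrow> W x \<in> \<U> (q3 + n) \<and> x \<in> W x \<and> (f ^^ n) ` W x = V ((f ^^ n) x)"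
        by metis
      have WU': "W x \<subseteq> U'" if x: "x \<in> G" for x
        using cover_maximal[of U' 0 n "W x"] W[OF x] U' VU[of "(f ^^ n) x"] x cover_element(2)[of "W x"]
        by (auto simp: G_def)
      define h where "h = c1 * D / 8"
      have l: "0 < h" using c1 D by (simp add: h_def)
      have \<kappa>D: "\<kappa> * D = h / 3 ^ P" by (simp add: h_def \<kappa>_def)
      have hP: "h / 3 ^ P \<le> h / 3 ^ card G"
        using l cardG by (intro divide_left_mono power_increasing) auto
      have "\<exists>v\<ge>\<psi> w. v + h / 3 ^ card G \<le> \<psi> w + h \<and> (\<forall>x\<in>G. \<psi> ` W x \<inter> {v..v + h / 3 ^ card G} = {})"
      proof (rule interval_avoiding[OF finG l])
        fix x s s' assume x: "x \<in> G" and "s \<in> \<psi> ` W x" "s' \<in> \<psi> ` W x"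
        then obtain t t' where t: "t \<in> W x" "s = \<psi> t" "t' \<in> W x" "s' = \<psi> t'" by blast
        have "W x \<subseteq> M" using WU'[OF x] U'M by auto
        then have "\<bar>s - s'\<bar> \<le> d t t'" using t one_lipschitzD[OF \<psi>, of t t'] by auto
        also have "\<dots> \<le> diam d (W x)" using t \<open>W x \<subseteq> M\<close> by (intro diam_upper mbounded_all)
        also have "\<dots> < \<kappa> * D" using q3(2) U'(1) W[OF x] WU'[OF x] unfolding D_def by blast
        also have "\<dots> \<le> h / 3 ^ card G" using \<kappa>D hP by simp
        finally show "\<bar>s - s'\<bar> < h / 3 ^ card G" .
      qed
      then obtain v where v: "\<psi> w \<le> v" "v + h / 3 ^ card G \<le> \<psi> w + h"
        "\<And>x. x \<in> G \<Longrightarrow> \<psi> ` W x \<inter> {v..v + h / 3 ^ card G} = {}" by blast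
      \<comment> \<open>Fits both into the interval that avoids the branch points and under the
        distance of the arms outside \<open>N\<close>.\<close>
      define L where "L = min (\<kappa> * D) (c2 * D)"
      define A' where "A' i = {y \<in> A i. (f ^^ n) y \<notin> N}" for i
      have img: "{v..v + L} \<subseteq> \<psi> ` A' k" if k: "k < 3" and z: "z \<in> A k" "\<psi> w + h < \<psi> z" for k z
      proof
        fix t assume t: "t \<in> {v..v + L}"
        have "L \<le> h / 3 ^ card G" using \<kappa>D hP by (simp add: L_def)
        then have t': "t \<in> {v..v + h / 3 ^ card G}" using t by auto
        then have "t \<in> {\<psi> w..\<psi> z}" using v(1,2) z by auto
        moreover have "{\<psi> w..\<psi> z} \<subseteq> \<psi> ` A k"
          using one_lipschitz_connected_image[OF \<psi> conA[OF k]] A[OF k] z by blast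
        ultimately obtain y where y: "y \<in> A k" "\<psi> y = t" by blast
        \<comment> \<open>A point of the arm over \<open>N\<close> lies in some \<open>W x\<close>,
          whose values the interval avoids.\<close>
        have "(f ^^ n) y \<notin> N"
        proof
          assume "(f ^^ n) y \<in> N"
          then obtain a where a: "a \<in> F" "(f ^^ n) y \<in> V a" by (auto simp: N_def)
          have yU: "y \<in> U'" using y AU[OF k] by auto
          obtain x where x: "x \<in> U'" "(f ^^ n) x = a" "y \<in> W x"
          proof (rule fibre_neighbourhoods_cover[OF U'(1) _ _ _ _ yU a(2), of q3 a W])
            show "V a \<in> \<U> q3" "a \<in> V a" using V[OF a(1)] by auto
            show "V a \<subseteq> (f ^^ n) ` U'" using VU[OF a(1)] U'(2) by simp
            fix x assume "x \<in> U'" "(f ^^ n) x = a"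
            then show "W x \<in> \<U> (q3 + n) \<and> x \<in> W x \<and> (f ^^ n) ` W x = V a" using W[of x] a(1) by (simp add: G_def)
          qed
          then have "x \<in> G" using a by (simp add: G_def)
          then show False using v(3) x y t' by blast
        qed
        then show "t \<in> \<psi> ` A' k" using y by (auto simp: A'_def)
      qed
      have sep: "L \<le> d x y" if x: "x \<in> A' i" and y: "y \<in> A' j" for x y
      proof -
        have xi: "x \<in> U'" "(f ^^ n) x \<in> B i" "(f ^^ n) x \<in> K i" using x A[OF ij(1)] AU[OF ij(1)] by (auto simp: A'_def K_def)
        have yi: "y \<in> M" "(f ^^ n) y \<in> K j" using y A[OF j] AU[OF j] U'M by (auto simp: A'_def K_def)
        have "c2 * diam d U' \<le> d x y"
        proof (rule c2(2)[OF U'(1) xi(1) yi(1)], rule conjI)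
          fix V assume V: "V \<in> \<U> q2" "(f ^^ n) x \<in> V"
          then have "V \<inter> (M - U) = {}" using q2(2) ij xi(2) by blast
          then show "V \<subseteq> (f ^^ n) ` U'" using cover_element_subset[OF V(1)] U'(2) by blast
          have "V \<inter> K i = {} \<or> V \<inter> K j = {}" using q2(1) ij V(1) by blast
          then show "(f ^^ n) y \<notin> V" using xi(3) yi(2) V(2) by blast
        qed
        then show ?thesis by (simp add: L_def D_def min_le_iff_disj)
      qed
      have "c * D \<le> L" using D by (simp add: L_def c_def mult_right_mono min_le_iff_disj)
      moreover have "A' i \<subseteq> U'" "A' j \<subseteq> U'" using AU[OF ij(1)] AU[OF j] by (auto simp: A'_def)
      moreover have "{v..v + L} \<subseteq> \<psi> ` A' i" using img[OF ij(1) x(1)] x(2) by (simp add: h_def)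
      moreover have "{v..v + L} \<subseteq> \<psi> ` A' j" using img[OF j y(1)] y(2) by (simp add: h_def)
      ultimately show ?thesis using sep
        by (intro exI[of _ "A' i"] exI[of _ "A' j"] exI[of _ v] exI[of _ L]) auto
    qed
    show "antenna_in U' (c * diam d U') \<phi>"
    \<comment> \<open>The threshold is L/8 for L = c1 D, as the first alternative of
      \<open>antenna_in\<close> asks. When every arm exceeds it, it is the length of the interval in
      which \<open>doubling\<close> searches.\<close>
    proof (cases "\<exists>i<3. \<forall>x\<in>A i. \<bar>\<phi> x - \<phi> w\<bar> \<le> c1 * D / 8")
      case True
      then obtain i where i: "i < 3" and flat: "\<forall>x\<in>A i. \<bar>\<phi> x - \<phi> w\<bar> \<le> c1 * D / 8" by blast
      obtain y where y: "y \<in> A i" "(f ^^ n) y = b i" using A[OF i] b[OF i] by (metis imageE)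
      then have yM: "y \<in> M" using AU[OF i] U'M by auto
      have "c1 * D \<le> d w y" unfolding D_def
      proof (rule c1(2)[OF U'(1) w(1) yM], rule conjI)
        fix V assume V: "V \<in> \<U> q1" "(f ^^ n) w \<in> V"
        then have "V \<inter> (M - U) = {}" using q1(1) w by blast
        then show "V \<subseteq> (f ^^ n) ` U'" using cover_element_subset[OF V(1)] U'(2) by blast
        have "V \<inter> {u} = {} \<or> V \<inter> {b i} = {}" using q1(2) i V(1) by blast
        then show "(f ^^ n) y \<notin> V" using V(2) w y by auto
      qed
      moreover have "{d w w..d w y} \<subseteq> d w ` A i"
        using one_lipschitz_connected_image[OF one_lipschitz_dist[OF wM] conA[OF i]] A[OF i] y by blast
      ultimately have "{0..c1 * D} \<subseteq> d w ` A i" using wM by auto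
      moreover have "c * diam d U' \<le> c1 * D" using D by (simp add: c_def D_def mult_right_mono)
      ultimately show ?thesis unfolding antenna_in_def
        using AU[OF i] one_lipschitz_dist[OF wM] flat
        by (intro disjI1 exI[of _ "A i"] exI[of _ "d w"] exI[of _ "c1 * D"] exI[of _ "\<phi> w"]) auto
    next
      case False
      then have "\<exists>x. x \<in> A i \<and> c1 * D / 8 < \<bar>\<phi> x - \<phi> w\<bar>" if "i < 3" for i using that by (meson not_le)
      then obtain x where x: "\<And>i. i < 3 \<Longrightarrow> x i \<in> A i \<and> c1 * D / 8 < \<bar>\<phi> (x i) - \<phi> w\<bar>" by metis
      define \<sigma> where "\<sigma> i \<longleftrightarrow> \<phi> w < \<phi> (x i)" for i :: nat
      have "\<exists>i<3. \<exists>j<i. \<sigma> i = \<sigma> j"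
      proof -
        have "\<sigma> 1 = \<sigma> 0 \<or> \<sigma> 2 = \<sigma> 0 \<or> \<sigma> 2 = \<sigma> 1" by blast
        moreover have "1 < (3::nat)" "2 < (3::nat)" "0 < (1::nat)" "0 < (2::nat)" "1 < (2::nat)" by simp_all
        ultimately show ?thesis by blast
      qed
      then obtain i j where ij: "i < 3" "j < i" "\<sigma> i = \<sigma> j" by blast
      have j: "j < 3" using ij by simp
      have c1D: "0 < c1 * D" using c1 D by simp
      show ?thesis
      proof (cases "\<sigma> i")
        case True
        then have "\<phi> w + c1 * D / 8 < \<phi> (x i)" "\<phi> w + c1 * D / 8 < \<phi> (x j)"
          using x[OF ij(1)] x[OF j] ij(3) by (auto simp: \<sigma>_def)
        from doubling[OF \<phi> ij(1,2) _ this(1) _ this(2)] show ?thesis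
          unfolding antenna_in_def using x[OF ij(1)] x[OF j] by (simp add: D_def)
      next
        case False
        then have "- \<phi> w + c1 * D / 8 < - \<phi> (x i)" "- \<phi> w + c1 * D / 8 < - \<phi> (x j)"
          using x[OF ij(1)] x[OF j] ij(3) c1D by (auto simp: \<sigma>_def)
        from doubling[OF one_lipschitz_uminus[OF \<phi>] ij(1,2) _ this(1) _ this(2)] x[OF ij(1)] x[OF j]
        obtain A B v L where AB: "A \<subseteq> U'" "B \<subseteq> U'" "c * D \<le> L" "{v..v + L} \<subseteq> (\<lambda>x. - \<phi> x) ` A"
            "{v..v + L} \<subseteq> (\<lambda>x. - \<phi> x) ` B" "\<forall>x\<in>A. \<forall>y\<in>B. L \<le> d x y" by blast
        have neg: "{- v - L..- v - L + L} \<subseteq> \<phi> ` E" if E: "{v..v + L} \<subseteq> (\<lambda>x. - \<phi> x) ` E" for E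
        proof
          fix t assume "t \<in> {- v - L..- v - L + L}"
          then have "- t \<in> {v..v + L}" by auto
          then obtain e where "e \<in> E" "- t = - \<phi> e" using E by blast
          then show "t \<in> \<phi> ` E" by auto
        qed
        show ?thesis unfolding antenna_in_def using AB neg[OF AB(4)] neg[OF AB(5)]
          by (intro disjI2 exI[of _ A] exI[of _ B] exI[of _ "- v - L"] exI[of _ L]) (auto simp: D_def)
      qed
    qed
  qed
qed

text \<open>An element of size comparable to \<open>r\<close> supplies the place, and finiteness of
  level 0 makes the antenna constant uniform. The cap at 1 meets the condition of the refinement
  estimates.\<close>

lemma antenna_like_of_tripod:
  assumes "tripod_centre p"
  obtains \<eta> r0 where "antenna_like \<eta> r0" "0 < \<eta>" "\<eta> \<le> 1" "0 < r0"
proof -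
  obtain g where g: "\<And>U. U \<in> \<U> 0 \<Longrightarrow> 0 < g U"
    "\<And>U n U' \<phi>. U \<in> \<U> 0 \<Longrightarrow> U' \<in> \<U> n \<Longrightarrow> (f ^^ n) ` U' = U \<Longrightarrow> one_lipschitz \<phi> \<Longrightarrow> antenna_in U' (g U * diam d U') \<phi>"
    using antenna_in_element[OF assms] by metis
  obtain c where c: "0 < c" "\<And>U. U \<in> \<U> 0 \<Longrightarrow> c \<le> g U"
    using finite_positive_lower_bound[OF finite_cover, of 0 g] g(1) by metis
  obtain c' r0 where c': "0 < c'" "0 < r0"
    "\<And>z r. z \<in> M \<Longrightarrow> 0 < r \<Longrightarrow> r \<le> r0 \<Longrightarrow> \<exists>n. \<exists>U\<in>\<U> n. z \<in> U \<and> diam d U < r \<and> c' * r \<le> diam d U"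
    by (rule element_at_scale) blast
  define \<eta> where "\<eta> = min 1 (c * c')"
  have "antenna_like \<eta> r0" unfolding antenna_like_def
  proof (intro ballI allI impI)
    fix z r \<phi> assume z: "z \<in> M" and r: "r \<in> {0<..r0}" and \<phi>: "one_lipschitz \<phi>"
    then obtain n U where U: "U \<in> \<U> n" "z \<in> U" "diam d U < r" "c' * r \<le> diam d U" using c'(3)[OF z, of r] by auto
    have fU: "(f ^^ n) ` U \<in> \<U> 0" using cover_image[of U 0 n] U by simp
    show "antenna_in (mball z r) (\<eta> * r) \<phi>"
    proof (rule antenna_in_mono[OF g(2)[OF fU U(1) refl \<phi>]])
      show "U \<subseteq> mball z r"
      proof
        fix y assume y: "y \<in> U"
        have UM: "U \<subseteq> M" using cover_element_subset[OF U(1)] .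
        have "d z y \<le> diam d U" using U y UM by (intro diam_upper mbounded_all)
        then show "y \<in> mball z r" using U UM y by auto
      qed
      have "\<eta> * r \<le> c * (c' * r)" using r by (simp add: \<eta>_def mult.assoc[symmetric] mult_right_mono)
      also have "\<dots> \<le> g ((f ^^ n) ` U) * diam d U" 
        using c(1) c(2)[OF fU] g(1)[OF fU] U(4) r c'(1) by (intro mult_mono) auto
      finally show "\<eta> * r \<le> g ((f ^^ n) ` U) * diam d U" .
    qed
  qed
  then show thesis using that[of \<eta> r0] c c' by (simp add: \<eta>_def)
qed

end

theorem corollary2:
  fixes X :: "'a topology" and f :: "'a \<Rightarrow> 'a"
  assumes "compact_space X" and "connected_space X" and "locally_connected_space X"
    and "metrizable_space X"
    and "topological_cxc X f"
    and "\<exists>S. S \<subseteq> topspace X \<and> top_of_set tripod homeomorphic_space subtopology X S"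
    and "conformal_dim X f = 1"
  shows "\<not> (\<exists>d\<in>canonical_gauge X f. hausdorff_dim (topspace X) d = conformal_dim X f)"
proof
  assume "\<exists>d\<in>canonical_gauge X f. hausdorff_dim (topspace X) d = conformal_dim X f"
  then obtain d where d: "metric_cxc X f d" "hausdorff_dim (topspace X) d = 1"
    using assms(7) by (auto simp: canonical_gauge_def)
  then obtain \<U>0 \<rho>m \<rho>p \<delta>m \<delta>p where cxc: "topological_cxc_wrt X f \<U>0" "metrizes X d"
    "increasing_embedding \<rho>m" "increasing_homeomorphism \<delta>m" "increasing_homeomorphism \<delta>p"
    "roundness_distortion X f \<U>0 d \<rho>m \<rho>p" "diameter_distortion X f \<U>0 d \<delta>m \<delta>p"
    unfolding metric_cxc_def by blast
  interpret Metric_space "topspace X" d using cxc(2) by (simp add: metrizes_def)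
  interpret metric_cxc_system X f \<U>0 d \<rho>m \<rho>p \<delta>m \<delta>p
    by unfold_locales (use cxc in \<open>simp_all add: metrizes_def\<close>)
  obtain S where S: "S \<subseteq> topspace X" "top_of_set tripod homeomorphic_space subtopology X S" using assms(6) by blast
  have "\<exists>p. tripod_centre p"
    by (rule tripod_arms[OF S]) (unfold tripod_centre_def, blast)
  then obtain p where "tripod_centre p" by blast
  then obtain \<eta> r0 where "antenna_like \<eta> r0" "0 < \<eta>" "\<eta> \<le> 1" "0 < r0" by (rule antenna_like_of_tripod)
  moreover obtain x y where "x \<in> topspace X" "y \<in> topspace X" "x \<noteq> y" by (rule two_points)
  ultimately have "1 < hausdorff_dim (topspace X) d"
    using assms(1,2) by (intro hausdorff_dim_gt_one[of \<eta> r0 x y]) (simp_all add: mtop)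
  then show False using d by simp
qed

end
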